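(* Let $\Phi=(G,\varphi)$ be a complex unit gain graph of order $n$ with $r(\Phi)=r(G)-2\theta(G)$. Then (a) the cycles (if any) of $G$ are pairwise vertex-disjoint; (b) each cycle $C_p^{\varphi}$ (if any) of $\Phi$ is of Type A with order $p\equiv 2\pmod 4$; (c) $r(G)=r(T_G)+\sum_{O\in\mathcal{C}(G)}|V(O)|$ and $r(T_G)=r(\Gamma_G)$.
   Context: A complex unit gain graph $\Phi=(G,\varphi)$ consists of a finite simple graph $G$ with vertex set $\{v_1,\dots,v_n\}$ and a gain function $\varphi$ assigning to each oriented edge $e_{ij}$ ($v_iv_j\in E(G)$) a complex number of modulus $1$ with $\varphi(e_{ji})=\overline{\varphi(e_{ij})}$. $A(\Phi)$ is the Hermitian matrix with $(i,j)$ entry $\varphi(e_{ij})$ if $v_iv_j\in E(G)$ and $0$ otherwise; $r(\Phi)$ is its rank; $r(\cdot)$ of a simple graph is the rank of its $0$-$1$ adjacency matrix. $\theta(G)=|E(G)|-|V(G)|+\omega(G)$, $\omega(G)$ the number of components. For a gain cycle with vertices $v_1,\dots,v_p$ in cyclic order, $\varphi(C_p)=\varphi(e_{12})\cdots\varphi(e_{p1})$; for $p$ even it is of Type A if $\varphi(C_p)=(-1)^{p/2}$. For a graph $G$ whose cycles are pairwise vertex-disjoint, $\mathcal{C}(G)$ is its set of cycles, and $T_G$ is the acyclic graph obtained by contracting each cycle $O$ to a vertex $t_O$: its vertex set is $U\cup C_G$, where $U$ is the set of vertices of $G$ on no cycle and $C_G=\{t_O:O\in\mathcal{C}(G)\}$;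 $u_1,u_2\in U$ are adjacent iff $u_1u_2\in E(G)$; $u\in U$ is adjacent to $t_O$ iff $u$ is adjacent in $G$ to some vertex of $O$; $t_{O_1},t_{O_2}$ are adjacent iff some edge of $G$ joins a vertex of $O_1$ to a vertex of $O_2$. $\Gamma_G$ is obtained from $T_G$ by deleting the vertices of $C_G$ and their incident edges. *)

theory Defs
  imports Complex_Main
begin

definition simple_graph :: "'a set \<Rightarrow> 'a set set \<Rightarrow> bool" where
  "simple_graph V E \<longleftrightarrow> finite V \<and>
     (\<forall>e\<in>E. \<exists>u v. e = {u, v} \<and> u \<noteq> v \<and> u \<in> V \<and> v \<in> V)"

text \<open>Complex unit gain graph (G, phi): phi u v is the gain of the oriented edge from u to v.\<close>
definition gain_graph :: "'a set \<Rightarrow> 'a set set \<Rightarrow> ('a \<Rightarrow> 'a \<Rightarrow> complex) \<Rightarrow> bool" where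
  "gain_graph V E \<phi> \<longleftrightarrow> simple_graph V E \<and>
     (\<forall>u v. {u, v} \<in> E \<longrightarrow> norm (\<phi> u v) = 1 \<and> \<phi> v u = cnj (\<phi> u v))"

definition adj_mat :: "'a set set \<Rightarrow> 'a \<Rightarrow> 'a \<Rightarrow> real" where
  "adj_mat E u v = (if {u, v} \<in> E then 1 else 0)"

definition gain_adj_mat :: "'a set set \<Rightarrow> ('a \<Rightarrow> 'a \<Rightarrow> complex) \<Rightarrow> 'a \<Rightarrow> 'a \<Rightarrow> complex" where
  "gain_adj_mat E \<phi> u v = (if {u, v} \<in> E then \<phi> u v else 0)"

definition cols_lin_indep :: "'a set \<Rightarrow> ('a \<Rightarrow> 'a \<Rightarrow> 'f::field) \<Rightarrow> 'a set \<Rightarrow> bool" where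
  "cols_lin_indep V M S \<longleftrightarrow>
     (\<forall>c. (\<forall>u\<in>V. (\<Sum>v\<in>S. c v * M u v) = 0) \<longrightarrow> (\<forall>v\<in>S. c v = 0))"

definition mat_rank :: "'a set \<Rightarrow> ('a \<Rightarrow> 'a \<Rightarrow> 'f::field) \<Rightarrow> nat" where
  "mat_rank V M = Max {card S | S. S \<subseteq> V \<and> cols_lin_indep V M S}"

definition graph_rank :: "'a set \<Rightarrow> 'a set set \<Rightarrow> nat" where
  "graph_rank V E = mat_rank V (adj_mat E)"

definition gain_rank :: "'a set \<Rightarrow> 'a set set \<Rightarrow> ('a \<Rightarrow> 'a \<Rightarrow> complex) \<Rightarrow> nat" where
  "gain_rank V E \<phi> = mat_rank V (gain_adj_mat E \<phi>)"

definition connected_rel :: "'a set \<Rightarrow> 'a set set \<Rightarrow> ('a \<times> 'a) set" where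
  "connected_rel V E = {(u, v). u \<in> V \<and> v \<in> V \<and> (u, v) \<in> {(x, y). {x, y} \<in> E}\<^sup>*}"

definition num_components :: "'a set \<Rightarrow> 'a set set \<Rightarrow> nat" where
  "num_components V E = card (V // connected_rel V E)"

definition theta :: "'a set \<Rightarrow> 'a set set \<Rightarrow> int" where
  "theta V E = int (card E) - int (card V) + int (num_components V E)"

definition cycle_list :: "'a set set \<Rightarrow> 'a list \<Rightarrow> bool" where
  "cycle_list E vs \<longleftrightarrow> distinct vs \<and> length vs \<ge> 3 \<and>
     (\<forall>i < length vs. {vs ! i, vs ! ((i + 1) mod length vs)} \<in> E)"

definition cycle_edges :: "'a list \<Rightarrow> 'a set set" where
  "cycle_edges vs = {{vs ! i, vs ! ((i + 1) mod length vs)} | i. i < length vs}"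

text \<open>The set C(G) of cycles of G; a cycle (a subgraph) is represented by its edge set.\<close>
definition cycles :: "'a set set \<Rightarrow> 'a set set set" where
  "cycles E = {cycle_edges vs | vs. cycle_list E vs}"

definition cyc_verts :: "'a set set \<Rightarrow> 'a set" where
  "cyc_verts C = \<Union> C"

definition cycle_gain :: "('a \<Rightarrow> 'a \<Rightarrow> complex) \<Rightarrow> 'a list \<Rightarrow> complex" where
  "cycle_gain \<phi> vs = (\<Prod>i < length vs. \<phi> (vs ! i) (vs ! ((i + 1) mod length vs)))"

definition type_A :: "('a \<Rightarrow> 'a \<Rightarrow> complex) \<Rightarrow> 'a list \<Rightarrow> bool" where
  "type_A \<phi> vs \<longleftrightarrow> even (length vs) \<and> cycle_gain \<phi> vs = (-1) ^ (length vs div 2)"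

definition non_cycle_verts :: "'a set \<Rightarrow> 'a set set \<Rightarrow> 'a set" where
  "non_cycle_verts V E = V - (\<Union>C\<in>cycles E. cyc_verts C)"

text \<open>T_G: vertices Inl u (u in U) and Inr C (the contracted vertex t_O of a cycle C).\<close>
definition TG_verts :: "'a set \<Rightarrow> 'a set set \<Rightarrow> ('a + 'a set set) set" where
  "TG_verts V E = Inl ` non_cycle_verts V E \<union> Inr ` cycles E"

definition TG_edges :: "'a set \<Rightarrow> 'a set set \<Rightarrow> ('a + 'a set set) set set" where
  "TG_edges V E =
     {{Inl u1, Inl u2} | u1 u2. u1 \<in> non_cycle_verts V E \<and> u2 \<in> non_cycle_verts V E \<and> {u1, u2} \<in> E}
   \<union> {{Inl u, Inr C} | u C. u \<in> non_cycle_verts V E \<and> C \<in> cycles E \<and>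
                          (\<exists>w\<in>cyc_verts C. {u, w} \<in> E)}
   \<union> {{Inr C1, Inr C2} | C1 C2. C1 \<in> cycles E \<and> C2 \<in> cycles E \<and> C1 \<noteq> C2 \<and>
                          (\<exists>x\<in>cyc_verts C1. \<exists>y\<in>cyc_verts C2. {x, y} \<in> E)}"

definition Gamma_verts :: "'a set \<Rightarrow> 'a set set \<Rightarrow> ('a + 'a set set) set" where
  "Gamma_verts V E = TG_verts V E - Inr ` cycles E"

definition Gamma_edges :: "'a set \<Rightarrow> 'a set set \<Rightarrow> ('a + 'a set set) set set" where
  "Gamma_edges V E = {e \<in> TG_edges V E. e \<subseteq> Gamma_verts V E}"

end

theory Submission
  imports Defs
begin

text \<open>
  Deleting a vertex lowers each of the two ranks by at most 2, and deleting a vertex of a cycle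
  lowers \<theta> by at least 1; as both ranks agree on forests, r(G) - 2 \<theta>(G) \<le> r(\<Phi>) follows by
  induction. If equality holds, every step of the induction is tight: for each vertex x on a cycle,
  G - x is again extremal, \<theta> drops by exactly 1, r(G - x) = r(G) - 2 and r(\<Phi> - x) = r(\<Phi>). The first
  fact makes the cycles disjoint. The two rank equations say that all kernel vectors of A(G)
  vanish at x and that some kernel vector of A(\<Phi>) does not; after removing the other cycles and all
  pendant vertices, this determines the gain and the length of the remaining cycle.

  For (c), use induction along a leaf of the forest T_G. A leaf outside the cycles is a pendant
  vertex of G. If the leaf is a cycle O, joined to the rest H = G - O by the edge xy, then
  r(G) = r(H) + |O|, and restricting a kernel vector of A(\<Phi>) that is nonzero at x shows
  r(\<Phi>_H) = r(\<Phi>_(H - y)) + 2. Hence y lies on no cycle and H - y is extremal, and the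
  induction hypotheses for H and H - y give the claim.
\<close>

section \<open>Ranks and kernels of Hermitian matrices\<close>

text \<open>On a lone cycle of length p, the kernel equation at a vertex ties its two neighbours
  together, so values propagate in steps of two. For odd p these steps reach every vertex, which
  allows nullity at most 1, while extremality demands at least 2. For even p a full turn multiplies
  the value by (-1)^(p/2) times the gain, so a nonzero value forces type A. Lengths divisible by 4
  are excluded on the side of the ordinary graph, whose kernel must vanish on cycles. The same
  recurrence explains why a pendant cycle can be cut off: type A makes its contribution to the row
  of the attachment vertex x zero, so the kernel vector survives restriction. In (c) the rank of T_G
  is compared with that of T_G - t_O through the formulas for H and H - y, because the ranks of G -
  O and G - O - y are the ones that can be computed directly.\<close>

lemma cols_lin_indepD:
  "cols_lin_indep R M S \<Longrightarrow> (\<And>u. u \<in> R \<Longrightarrow> (\<Sum>v\<in>S. c v * M u v) = 0) \<Longrightarrow> v \<in> S \<Longrightarrow> c v = 0"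
  unfolding cols_lin_indep_def by blast

lemma cols_lin_indep_more_rows: "cols_lin_indep R M S \<Longrightarrow> R \<subseteq> R' \<Longrightarrow> cols_lin_indep R' M S"
  unfolding cols_lin_indep_def by blast

lemma cols_lin_indep_subset:
  assumes "cols_lin_indep R M S" "S' \<subseteq> S" "finite S"
  shows "cols_lin_indep R M S'"
  unfolding cols_lin_indep_def
proof (intro allI impI ballI)
  fix c v assume c: "\<forall>u\<in>R. (\<Sum>v\<in>S'. c v * M u v) = 0" and v: "v \<in> S'"
  let ?d = "\<lambda>v. if v \<in> S' then c v else 0"
  have "(\<Sum>v\<in>S. ?d v * M u v) = 0" if "u \<in> R" for u
  proof -
    have "(\<Sum>v\<in>S. ?d v * M u v) = (\<Sum>v\<in>S'. c v * M u v)"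
      by (rule sum.mono_neutral_cong_right) (use assms in auto)
    then show ?thesis using c that by simp
  qed
  from cols_lin_indepD[OF assms(1) this, of v] v assms(2) show "c v = 0" by auto
qed

lemma mat_rank_attained:
  assumes "finite V"
  obtains S where "S \<subseteq> V" "cols_lin_indep V M S" "card S = mat_rank V M"
proof -
  let ?A = "{card S | S. S \<subseteq> V \<and> cols_lin_indep V M S}"
  have "finite ?A" by (rule finite_subset[of _ "card ` Pow V"]) (use assms in auto)
  moreover have "card {} \<in> ?A" by (intro CollectI exI[of _ "{}"]) (auto simp: cols_lin_indep_def)
  ultimately have "Max ?A \<in> ?A" by (intro Max_in) auto
  then show ?thesis using that unfolding mat_rank_def by auto
qed

lemma card_le_mat_rank:
  assumes "finite V" "S \<subseteq> V" "cols_lin_indep V M S"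
  shows "card S \<le> mat_rank V M"
proof -
  let ?A = "{card S | S. S \<subseteq> V \<and> cols_lin_indep V M S}"
  have "finite ?A" by (rule finite_subset[of _ "card ` Pow V"]) (use assms in auto)
  then show ?thesis unfolding mat_rank_def using assms by (intro Max_ge) auto
qed

lemma mat_rank_cong:
  assumes "\<And>u v. u \<in> V \<Longrightarrow> v \<in> V \<Longrightarrow> M u v = N u v"
  shows "mat_rank V M = mat_rank V N"
proof -
  have "cols_lin_indep V M S = cols_lin_indep V N S" if "S \<subseteq> V" for S
  proof -
    have "(\<Sum>v\<in>S. c v * M u v) = (\<Sum>v\<in>S. c v * N u v)" if "u \<in> V" for u c
      by (rule sum.cong) (use assms that \<open>S \<subseteq> V\<close> in auto)
    then show ?thesis unfolding cols_lin_indep_def by auto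
  qed
  then have "{card S | S. S \<subseteq> V \<and> cols_lin_indep V M S} = {card S | S. S \<subseteq> V \<and> cols_lin_indep V N S}"
    by blast
  then show ?thesis unfolding mat_rank_def by simp
qed

text \<open>If \<open>S\<close> becomes dependent without row \<open>x\<close>, its dependencies
  form a line: any two can be combined so that row \<open>x\<close> cancels as well. Dropping one
  column used by that dependency restores independence.\<close>

lemma cols_lin_indep_delete_row:
  assumes "cols_lin_indep R M S" "finite S"
  obtains S' where "S' \<subseteq> S" "cols_lin_indep (R - {x}) M S'" "card S \<le> card S' + 1"
proof (cases "cols_lin_indep (R - {x}) M S")
  case True
  then show ?thesis using that[of S] by simp
next
  case False
  then obtain c s where c: "\<And>u. u \<in> R - {x} \<Longrightarrow> (\<Sum>v\<in>S. c v * M u v) = 0" and s: "s \<in> S" "c s \<noteq> 0"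
    unfolding cols_lin_indep_def by blast
  let ?cx = "\<Sum>v\<in>S. c v * M x v"
  have "cols_lin_indep (R - {x}) M (S - {s})"
    unfolding cols_lin_indep_def
  proof (intro allI impI ballI)
    fix d v assume d: "\<forall>u\<in>R - {x}. (\<Sum>v\<in>S-{s}. d v * M u v) = 0" and v: "v \<in> S - {s}"
    define d' where "d' = (\<lambda>v. if v = s then 0 else d v)"
    have d': "(\<Sum>v\<in>S. d' v * M u v) = (\<Sum>v\<in>S-{s}. d v * M u v)" for u
      by (rule sum.mono_neutral_cong_right) (use assms(2) in \<open>auto simp: d'_def\<close>)
    let ?dx = "\<Sum>v\<in>S. d' v * M x v"
    \<comment> \<open>This combination of \<open>c\<close> and \<open>d'\<close> cancels row
      \<open>x\<close> too, so independence on \<open>R\<close> makes it zero; its coefficient at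
      \<open>s\<close> is \<open>?dx * c s\<close>, hence \<open>?dx = 0\<close>.\<close>
    have "(\<Sum>v\<in>S. (?dx * c v - ?cx * d' v) * M u v) = 0" if "u \<in> R" for u
    proof -
      have e: "(\<Sum>v\<in>S. (?dx * c v - ?cx * d' v) * M u v)
          = ?dx * (\<Sum>v\<in>S. c v * M u v) - ?cx * (\<Sum>v\<in>S. d' v * M u v)"
        by (simp add: sum_distrib_left sum_subtractf left_diff_distrib mult.assoc)
      show ?thesis
      proof (cases "u = x")
        case True then show ?thesis using e by (simp add: mult.commute)
      next
        case False
        then show ?thesis using e c[of u] d d'[of u] that by simp
      qed
    qed
    from cols_lin_indepD[OF assms(1) this s(1)] have "?dx = 0" using s(2) by (simp add: d'_def)
    then have "(\<Sum>v\<in>S. d' v * M u v) = 0" if "u \<in> R" for u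
      using d d' that by (cases "u = x") auto
    from cols_lin_indepD[OF assms(1) this, of v] v show "d v = 0" by (auto simp: d'_def)
  qed
  then show ?thesis using that[of "S - {s}"] card.remove[OF assms(2) s(1)] by simp
qed

lemma mat_rank_delete_le:
  assumes "finite V" shows "mat_rank (V - {x}) M \<le> mat_rank V M"
proof -
  obtain S where "S \<subseteq> V - {x}" "cols_lin_indep (V - {x}) M S" "card S = mat_rank (V - {x}) M"
    by (rule mat_rank_attained[OF finite_Diff[OF assms]])
  then show ?thesis
    using card_le_mat_rank[OF assms, of S M] cols_lin_indep_more_rows[of "V - {x}" M S V] by auto
qed

text \<open>Column \<open>x\<close> and row \<open>x\<close> go one after the other, and each costs
  at most one independent column.\<close>

lemma mat_rank_le_delete:
  assumes "finite V" shows "mat_rank V M \<le> mat_rank (V - {x}) M + 2"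
proof -
  obtain S where S: "S \<subseteq> V" "cols_lin_indep V M S" "card S = mat_rank V M"
    by (rule mat_rank_attained[OF assms])
  have fin: "finite S" using S assms finite_subset by blast
  then have "cols_lin_indep V M (S - {x})" using cols_lin_indep_subset[OF S(2)] by blast
  then obtain S' where S': "S' \<subseteq> S - {x}" "cols_lin_indep (V - {x}) M S'" "card (S - {x}) \<le> card S' + 1"
    by (rule cols_lin_indep_delete_row[OF _ finite_Diff[OF fin]])
  have "card S' \<le> mat_rank (V - {x}) M"
    by (rule card_le_mat_rank) (use assms S S' in auto)
  moreover have "card S \<le> card (S - {x}) + 1" by (simp add: card_Diff_singleton_if) arith
  ultimately show ?thesis using S S' by linarith
qed

section \<open>Kernel vectors and the deletion of a vertex\<close>

definition in_kernel :: "'a set \<Rightarrow> ('a \<Rightarrow> 'a \<Rightarrow> 'f::field) \<Rightarrow> ('a \<Rightarrow> 'f) \<Rightarrow> bool" where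
  "in_kernel V M c \<longleftrightarrow> (\<forall>u\<in>V. (\<Sum>v\<in>V. c v * M u v) = 0)"

text \<open>The columns outside \<open>S\<close> outnumber the rank, so they are dependent, and the
  dependency is extended by 0. On an odd cycle this turns nullity 2 into a nonzero kernel vector
  with a prescribed zero.\<close>

lemma kernel_vector_vanishing_on:
  assumes "finite V" "S \<subseteq> V" "mat_rank V M + card S < card V"
  obtains c v where "in_kernel V M c" "\<And>s. s \<in> S \<Longrightarrow> c s = 0" "v \<in> V" "c v \<noteq> 0"
proof -
  have "card (V - S) = card V - card S"
    using assms(1,2) by (intro card_Diff_subset) (auto intro: finite_subset)
  then have "\<not> card (V - S) \<le> mat_rank V M" using assms by linarith
  then have "\<not> cols_lin_indep V M (V - S)" using card_le_mat_rank[of V "V - S"] assms by blast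
  then obtain c v where c: "\<And>u. u \<in> V \<Longrightarrow> (\<Sum>v\<in>V-S. c v * M u v) = 0" and v: "v \<in> V - S" "c v \<noteq> 0"
    unfolding cols_lin_indep_def by blast
  let ?c = "\<lambda>v. if v \<in> S then 0 else c v"
  have "(\<Sum>v\<in>V. ?c v * M u v) = (\<Sum>v\<in>V-S. c v * M u v)" for u
    by (rule sum.mono_neutral_cong_right) (use assms in auto)
  then show ?thesis using that[of ?c v] c v unfolding in_kernel_def by auto
qed

text \<open>A largest independent column set for \<open>V - {x}\<close> stays independent when row
  \<open>x\<close> returns and already attains the rank. Adjoining column \<open>x\<close> therefore
  creates a dependency, which must involve \<open>x\<close>.\<close>

lemma kernel_vector_if_rank_delete_eq:
  assumes "finite V" "x \<in> V" "mat_rank (V - {x}) M = mat_rank V M"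
  obtains c where "in_kernel V M c" "c x \<noteq> 0"
proof -
  obtain S where S: "S \<subseteq> V - {x}" "cols_lin_indep (V - {x}) M S" "card S = mat_rank (V - {x}) M"
    by (rule mat_rank_attained[OF finite_Diff[OF assms(1)]])
  have fin: "finite S" using S assms finite_subset by blast
  have ind: "cols_lin_indep V M S" using cols_lin_indep_more_rows[OF S(2)] by blast
  have "card (insert x S) = mat_rank V M + 1" using S fin assms by (subst card_insert_disjoint) auto
  then have "\<not> cols_lin_indep V M (insert x S)"
    using card_le_mat_rank[of V "insert x S" M] assms S by auto
  then obtain c v where c: "\<And>u. u \<in> V \<Longrightarrow> (\<Sum>v\<in>insert x S. c v * M u v) = 0"
    and v: "v \<in> insert x S" "c v \<noteq> 0"
    unfolding cols_lin_indep_def by blast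
  have "c x \<noteq> 0"
  proof
    assume "c x = 0"
    then have "(\<Sum>v\<in>S. c v * M u v) = 0" if "u \<in> V" for u
      using c[OF that] fin S by (subst (asm) sum.insert) auto
    from cols_lin_indepD[OF ind this, of v] v \<open>c x = 0\<close> show False by auto
  qed
  moreover have "in_kernel V M (\<lambda>v. if v \<in> insert x S then c v else 0)"
    unfolding in_kernel_def
  proof
    fix u assume "u \<in> V"
    have "(\<Sum>v\<in>V. (if v \<in> insert x S then c v else 0) * M u v) = (\<Sum>v\<in>insert x S. c v * M u v)"
      by (rule sum.mono_neutral_cong_right) (use assms S in auto)
    then show "(\<Sum>v\<in>V. (if v \<in> insert x S then c v else 0) * M u v) = 0" using c[OF \<open>u \<in> V\<close>] by simp
  qed
  ultimately show ?thesis using that by auto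
qed

text \<open>The negated premise is the form in which a failed search for an exchange column delivers
  the dependency.\<close>

lemma col_in_span_if_dependent:
  fixes M :: "'a \<Rightarrow> 'a \<Rightarrow> 'f::field"
  assumes "finite S" "cols_lin_indep R M S" "\<not> (v \<notin> S \<and> cols_lin_indep R M (insert v S))"
  shows "\<exists>b. \<forall>u\<in>R. M u v = (\<Sum>s\<in>S. b s * M u s)"
proof (cases "v \<in> S")
  case True
  have "M u v = (\<Sum>s\<in>S. (if s = v then 1 else 0) * M u s)" for u
  proof -
    have "(\<Sum>s\<in>S. (if s = v then 1 else 0) * M u s) = (\<Sum>s\<in>S. if s = v then M u v else 0)"
      by (rule sum.cong) auto
    then show ?thesis using True assms(1) by simp
  qed
  then show ?thesis by (intro exI[of _ "\<lambda>s. if s = v then 1 else 0"]) blast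
next
  case False
  then obtain c w where c: "\<And>u. u \<in> R \<Longrightarrow> (\<Sum>s\<in>insert v S. c s * M u s) = 0"
    and w: "w \<in> insert v S" "c w \<noteq> 0"
    using assms(3) unfolding cols_lin_indep_def by blast
  have c': "c v * M u v + (\<Sum>s\<in>S. c s * M u s) = 0" if "u \<in> R" for u
    using c[OF that] False assms(1) by simp
  have "c v \<noteq> 0"
  proof
    assume "c v = 0"
    then have "(\<Sum>s\<in>S. c s * M u s) = 0" if "u \<in> R" for u using c'[OF that] by simp
    from cols_lin_indepD[OF assms(2) this, of w] w \<open>c v = 0\<close> show False by auto
  qed
  have "M u v = (\<Sum>s\<in>S. (- c s / c v) * M u s)" if "u \<in> R" for u
  proof -
    have "(\<Sum>s\<in>S. (- c s / c v) * M u s) = - (\<Sum>s\<in>S. c s * M u s) / c v"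
      by (simp add: sum_divide_distrib sum_negf)
    also have "- (\<Sum>s\<in>S. c s * M u s) = c v * M u v" using c'[OF that] by (intro minus_unique) (simp only: add.commute)
    finally show ?thesis using \<open>c v \<noteq> 0\<close> by simp
  qed
  then show ?thesis by (intro exI[of _ "\<lambda>s. - c s / c v"]) blast
qed

definition hermitian_on :: "'a set \<Rightarrow> ('a \<Rightarrow> 'a \<Rightarrow> complex) \<Rightarrow> bool" where
  "hermitian_on V M \<longleftrightarrow> (\<forall>u\<in>V. \<forall>v\<in>V. M v u = cnj (M u v))"

lemma hermitian_onD: "hermitian_on V M \<Longrightarrow> u \<in> V \<Longrightarrow> v \<in> V \<Longrightarrow> cnj (M u v) = M v u"
  unfolding hermitian_on_def by metis

text \<open>Column \<open>x\<close> is a combination of the other columns, so some largest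
  independent column set avoids it; conjugating that relation shows that row \<open>x\<close> is a
  combination of the other rows, so this set stays independent without row \<open>x\<close>.\<close>

lemma rank_delete_eq_if_kernel_vector:
  assumes fin: "finite V" and herm: "hermitian_on V M" and x: "x \<in> V"
    and ker: "in_kernel V M c" and cx: "c x \<noteq> 0"
  shows "mat_rank (V - {x}) M = mat_rank V M"
proof -
  obtain S where S: "S \<subseteq> V" "cols_lin_indep V M S" "card S = mat_rank V M"
    by (rule mat_rank_attained[OF fin])
  have finS: "finite S" using S fin finite_subset by blast
  have split: "(\<Sum>v\<in>V. c v * M u v) = c x * M u x + (\<Sum>v\<in>V-{x}. c v * M u v)" for u
    using fin x by (rule sum.remove)
  have colx: "M u x = (\<Sum>v\<in>V-{x}. (- c v / c x) * M u v)" if "u \<in> V" for u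
  proof -
    have "(\<Sum>v\<in>V-{x}. (- c v / c x) * M u v) = - (\<Sum>v\<in>V-{x}. c v * M u v) / c x"
      by (simp add: sum_divide_distrib sum_negf)
    also have "- (\<Sum>v\<in>V-{x}. c v * M u v) = c x * M u x"
      using ker that split[of u] unfolding in_kernel_def
      by (intro minus_unique) (simp only: add.commute)
    finally show ?thesis using cx by simp
  qed
  \<comment> \<open>Exchange: if \<open>x\<close> belongs to \<open>S\<close>, another column takes
    its place.\<close>
  obtain T where T: "T \<subseteq> V - {x}" "cols_lin_indep V M T" "card T = card S"
  proof (cases "x \<in> S")
    case False
    then show ?thesis using that[of S] S by blast
  next
    case True
    have ind: "cols_lin_indep V M (S - {x})" using cols_lin_indep_subset[OF S(2) _ finS] by blast
    have "\<exists>v\<in>V - {x}. v \<notin> S - {x} \<and> cols_lin_indep V M (insert v (S - {x}))"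
    proof (rule ccontr)
      assume "\<not> ?thesis"
      then have "\<forall>v\<in>V-{x}. \<exists>b. \<forall>u\<in>V. M u v = (\<Sum>s\<in>S-{x}. b s * M u s)"
        using col_in_span_if_dependent[OF _ ind] finS by blast
      then obtain b where b: "\<And>u v. v \<in> V - {x} \<Longrightarrow> u \<in> V \<Longrightarrow> M u v = (\<Sum>s\<in>S-{x}. b v s * M u s)"
        by metis
      \<comment> \<open>If no column could replace \<open>x\<close>, all other columns, and with
        them column \<open>x\<close>, would lie in the span of \<open>S - {x}\<close>;
        \<open>d\<close> records this relation with coefficient -1 at \<open>x\<close>.\<close>
      define d where "d = (\<lambda>s. if s = x then - 1 else (\<Sum>v\<in>V-{x}. (- c v / c x) * b v s))"
      have "(\<Sum>s\<in>S. d s * M u s) = 0" if "u \<in> V" for u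
      proof -
        have "M u x = (\<Sum>v\<in>V-{x}. (- c v / c x) * (\<Sum>s\<in>S-{x}. b v s * M u s))"
          unfolding colx[OF that] by (rule sum.cong[OF refl]) (simp add: b[OF _ that])
        also have "\<dots> = (\<Sum>v\<in>V-{x}. \<Sum>s\<in>S-{x}. (- c v / c x) * b v s * M u s)"
          by (simp add: sum_distrib_left mult.assoc)
        also have "\<dots> = (\<Sum>s\<in>S-{x}. \<Sum>v\<in>V-{x}. (- c v / c x) * b v s * M u s)"
          by (rule sum.swap)
        also have "\<dots> = (\<Sum>s\<in>S-{x}. d s * M u s)"
          by (rule sum.cong[OF refl]) (simp add: d_def sum_distrib_right)
        finally have "M u x = (\<Sum>s\<in>S-{x}. d s * M u s)" .
        moreover have "(\<Sum>s\<in>S. d s * M u s) = d x * M u x + (\<Sum>s\<in>S-{x}. d s * M u s)"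
          using finS True by (rule sum.remove)
        ultimately show ?thesis by (simp add: d_def)
      qed
      from cols_lin_indepD[OF S(2) this True] show False by (simp add: d_def)
    qed
    then obtain v where v: "v \<in> V - {x}" "v \<notin> S - {x}" "cols_lin_indep V M (insert v (S - {x}))" by blast
    moreover have "card (insert v (S - {x})) = card S"
      using v finS card.remove[OF finS True] by (simp add: card_insert_if)
    ultimately show ?thesis using that[of "insert v (S - {x})"] S by auto
  qed
  have "cols_lin_indep (V - {x}) M T"
    unfolding cols_lin_indep_def
  proof (intro allI impI ballI)
    fix d v assume d: "\<forall>u\<in>V - {x}. (\<Sum>v\<in>T. d v * M u v) = 0" and v: "v \<in> T"
    have rowx: "M x v = (\<Sum>u\<in>V-{x}. cnj (- c u / c x) * M u v)" if "v \<in> V" for v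
    proof -
      have "M x v = cnj (M v x)" by (rule hermitian_onD[OF herm that x, symmetric])
      also have "\<dots> = (\<Sum>u\<in>V-{x}. cnj (- c u / c x) * cnj (M v u))"
        unfolding colx[OF that] by (simp add: cnj_sum)
      also have "\<dots> = (\<Sum>u\<in>V-{x}. cnj (- c u / c x) * M u v)"
        by (rule sum.cong[OF refl]) (use that in \<open>simp add: hermitian_onD[OF herm]\<close>)
      finally show ?thesis .
    qed
    have "(\<Sum>v\<in>T. d v * M x v) = (\<Sum>v\<in>T. \<Sum>u\<in>V-{x}. cnj (- c u / c x) * (d v * M u v))"
    proof (rule sum.cong[OF refl])
      fix v assume "v \<in> T"
      then have "v \<in> V" using T by blast
      show "d v * M x v = (\<Sum>u\<in>V-{x}. cnj (- c u / c x) * (d v * M u v))"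
        unfolding rowx[OF \<open>v \<in> V\<close>] sum_distrib_left by (rule sum.cong) auto
    qed
    also have "\<dots> = (\<Sum>u\<in>V-{x}. cnj (- c u / c x) * (\<Sum>v\<in>T. d v * M u v))"
      by (subst sum.swap) (simp add: sum_distrib_left)
    also have "\<dots> = 0" using d by simp
    finally have "(\<Sum>v\<in>T. d v * M u v) = 0" if "u \<in> V" for u using d that by (cases "u = x") auto
    from cols_lin_indepD[OF T(2) this v] show "d v = 0" .
  qed
  then have "card T \<le> mat_rank (V - {x}) M" using card_le_mat_rank[of "V - {x}" T M] T fin by blast
  then show ?thesis using T S mat_rank_delete_le[OF fin, of x M] by simp
qed

text \<open>Row \<open>x\<close> is zero, by symmetry so is column \<open>x\<close>, and the
  indicator of \<open>x\<close> is a kernel vector.\<close>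

lemma mat_rank_delete_isolated:
  assumes "finite V" "hermitian_on V M" "x \<in> V" "\<And>v. v \<in> V \<Longrightarrow> M x v = 0"
  shows "mat_rank (V - {x}) M = mat_rank V M"
proof (rule rank_delete_eq_if_kernel_vector[OF assms(1-3)])
  let ?c = "\<lambda>v. if v = x then 1 else (0::complex)"
  have "?c v * M u v = 0" if "u \<in> V" "v \<in> V" for u v
    using that assms(4)[of u] hermitian_onD[OF assms(2), of x u] assms(3) by auto
  then show "in_kernel V M ?c" unfolding in_kernel_def by (intro ballI sum.neutral) auto
qed auto

lemma hermitian_on_subset: "hermitian_on V M \<Longrightarrow> W \<subseteq> V \<Longrightarrow> hermitian_on W M"
  unfolding hermitian_on_def by blast

text \<open>Upper bound: removing \<open>u\<close> costs at most 2 and isolates \<open>v\<close>.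
  Lower bound: columns \<open>u\<close> and \<open>v\<close> can join any independent set of the
  rest, since row \<open>v\<close> sees only column \<open>u\<close>, and column \<open>v\<close> is
  zero outside row \<open>u\<close>.\<close>

lemma mat_rank_delete_pendant:
  assumes fin: "finite V" and herm: "hermitian_on V M" and uv: "u \<in> V" "v \<in> V" "u \<noteq> v"
    and vu: "M v u \<noteq> 0" and pend: "\<And>w. w \<in> V \<Longrightarrow> w \<noteq> u \<Longrightarrow> M v w = 0"
  shows "mat_rank V M = mat_rank (V - {u, v}) M + 2"
proof (rule antisym)
  have "mat_rank (V - {u} - {v}) M = mat_rank (V - {u}) M"
    by (rule mat_rank_delete_isolated)
      (use assms hermitian_on_subset[OF herm, of "V - {u}"] in auto)
  moreover have "V - {u} - {v} = V - {u, v}" by auto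
  ultimately show "mat_rank V M \<le> mat_rank (V - {u, v}) M + 2"
    using mat_rank_le_delete[OF fin, of M u] by simp
next
  obtain S where S: "S \<subseteq> V - {u, v}" "cols_lin_indep (V - {u, v}) M S" "card S = mat_rank (V - {u, v}) M"
    by (rule mat_rank_attained[OF finite_Diff[OF fin]])
  have finS: "finite S" using S fin finite_subset by blast
  have notin: "u \<notin> S" "v \<notin> S" using S by auto
  have col: "M w v = 0" if "w \<in> V" "w \<noteq> u" for w
    using hermitian_onD[OF herm uv(2) that(1)] pend[OF that] by simp
  have uv0: "M u v \<noteq> 0" using hermitian_onD[OF herm uv(1,2)] vu by auto
  have "cols_lin_indep V M (insert u (insert v S))"
    unfolding cols_lin_indep_def
  proof (intro allI impI)
    fix c assume c: "\<forall>w\<in>V. (\<Sum>s\<in>insert u (insert v S). c s * M w s) = 0"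
    have c': "c u * M w u + (c v * M w v + (\<Sum>s\<in>S. c s * M w s)) = 0" if "w \<in> V" for w
      using c that notin finS uv by simp
    have "(\<Sum>s\<in>S. c s * M v s) = 0"
      by (rule sum.neutral) (use S pend in auto)
    then have cu: "c u = 0" using c'[OF uv(2)] pend[OF uv(2)] uv vu by auto
    have "(\<Sum>s\<in>S. c s * M w s) = 0" if "w \<in> V - {u, v}" for w
      using c'[of w] cu col[of w] that by auto
    then have cS: "\<And>s. s \<in> S \<Longrightarrow> c s = 0" using cols_lin_indepD[OF S(2)] by blast
    then have "(\<Sum>s\<in>S. c s * M u s) = 0" by (intro sum.neutral) auto
    then have "c v = 0" using c'[OF uv(1)] cu uv0 by auto
    then show "\<forall>s\<in>insert u (insert v S). c s = 0" using cu cS by auto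
  qed
  from card_le_mat_rank[OF fin _ this] show "mat_rank (V - {u, v}) M + 2 \<le> mat_rank V M"
    using S uv notin finS by (auto simp: subset_iff)
qed

text \<open>Real and imaginary parts of a complex dependency are real dependencies. This turns the
  rank of the real adjacency matrix into a complex rank, to which the Hermitian lemmas
  apply.\<close>

lemma cols_lin_indep_complex_of_real:
  "cols_lin_indep V (\<lambda>u v. complex_of_real (M u v)) S \<longleftrightarrow> cols_lin_indep V M S"
proof
  assume L: "cols_lin_indep V (\<lambda>u v. complex_of_real (M u v)) S"
  show "cols_lin_indep V M S"
    unfolding cols_lin_indep_def
  proof (intro allI impI ballI)
    fix c v assume c: "\<forall>u\<in>V. (\<Sum>v\<in>S. c v * M u v) = 0" and v: "v \<in> S"
    have "(\<Sum>v\<in>S. complex_of_real (c v) * complex_of_real (M u v)) = 0" if "u \<in> V" for u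
    proof -
      have "(\<Sum>v\<in>S. complex_of_real (c v) * complex_of_real (M u v)) = complex_of_real (\<Sum>v\<in>S. c v * M u v)"
        by simp
      then show ?thesis using c that by simp
    qed
    from cols_lin_indepD[OF L this v] show "c v = 0" by simp
  qed
next
  assume R: "cols_lin_indep V M S"
  show "cols_lin_indep V (\<lambda>u v. complex_of_real (M u v)) S"
    unfolding cols_lin_indep_def
  proof (intro allI impI ballI)
    fix c :: "_ \<Rightarrow> complex" and v
    assume c: "\<forall>u\<in>V. (\<Sum>v\<in>S. c v * complex_of_real (M u v)) = 0" and v: "v \<in> S"
    have "(\<Sum>v\<in>S. Re (c v) * M u v) = 0" "(\<Sum>v\<in>S. Im (c v) * M u v) = 0" if "u \<in> V" for u
    proof -
      have "(\<Sum>v\<in>S. Re (c v) * M u v) = Re (\<Sum>v\<in>S. c v * complex_of_real (M u v))"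
        "(\<Sum>v\<in>S. Im (c v) * M u v) = Im (\<Sum>v\<in>S. c v * complex_of_real (M u v))" by simp_all
      then show "(\<Sum>v\<in>S. Re (c v) * M u v) = 0" "(\<Sum>v\<in>S. Im (c v) * M u v) = 0" using c that by simp_all
    qed
    from cols_lin_indepD[OF R this(1) v] cols_lin_indepD[OF R this(2) v] show "c v = 0"
      by (simp add: complex_eq_iff)
  qed
qed

text \<open>With all gains equal to 1, every fact about gain ranks specialises to
  \<open>graph_rank\<close>.\<close>

lemma graph_rank_eq_gain_rank: "graph_rank V E = gain_rank V E (\<lambda>_ _. 1)"
proof -
  have "gain_adj_mat E (\<lambda>_ _. 1) = (\<lambda>u v. complex_of_real (adj_mat E u v))"
    by (intro ext) (simp add: gain_adj_mat_def adj_mat_def)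
  then show ?thesis
    unfolding graph_rank_def gain_rank_def mat_rank_def by (simp add: cols_lin_indep_complex_of_real)
qed

section \<open>Cyclomatic number and cycles\<close>

definition reach :: "'a set set \<Rightarrow> 'a \<Rightarrow> 'a \<Rightarrow> bool" where
  "reach E u v \<longleftrightarrow> (u, v) \<in> {(x, y). {x, y} \<in> E}\<^sup>*"

definition del_edges :: "'a set set \<Rightarrow> 'a set \<Rightarrow> 'a set set" where
  "del_edges E S = {e \<in> E. e \<inter> S = {}}"

lemma reach_refl [simp]: "reach E u u"
  unfolding reach_def by simp

lemma reach_edge: "{u, v} \<in> E \<Longrightarrow> reach E u v"
  unfolding reach_def by (rule r_into_rtrancl) simp

lemma reach_trans: "reach E u v \<Longrightarrow> reach E v w \<Longrightarrow> reach E u w"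
  unfolding reach_def by (rule rtrancl_trans)

lemma reach_sym: "reach E u v \<Longrightarrow> reach E v u"
proof -
  have "sym {(x, y). {x, y} \<in> E}" by (auto intro!: symI simp: insert_commute)
  then show "reach E u v \<Longrightarrow> reach E v u" unfolding reach_def by (metis sym_rtrancl symD)
qed

lemma reach_mono: "reach E u v \<Longrightarrow> E \<subseteq> E' \<Longrightarrow> reach E' u v"
  unfolding reach_def by (erule rtrancl_mono[THEN subsetD, rotated]) auto

lemma reach_induct [consumes 1, case_names refl step]:
  assumes "reach E u v" "P u" "\<And>x y. reach E u x \<Longrightarrow> {x, y} \<in> E \<Longrightarrow> P x \<Longrightarrow> P y"
  shows "P v"
  using assms(1) unfolding reach_def
  by (induction rule: rtrancl_induct) (use assms(2,3) in \<open>auto simp: reach_def\<close>)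

lemma reach_closed:
  assumes "reach E u v" "u \<in> A" "\<And>x y. x \<in> A \<Longrightarrow> {x, y} \<in> E \<Longrightarrow> y \<in> A"
  shows "v \<in> A"
  using assms(1) by (induction rule: reach_induct) (use assms(2,3) in auto)

lemma simple_graphD:
  assumes "simple_graph V E" "{u, v} \<in> E"
  shows "u \<in> V" "v \<in> V" "u \<noteq> v"
  using assms unfolding simple_graph_def by (metis doubleton_eq_iff)+

lemma simple_graph_finite: "simple_graph V E \<Longrightarrow> finite V"
  unfolding simple_graph_def by blast

lemma simple_graph_edges_Pow: "simple_graph V E \<Longrightarrow> E \<subseteq> Pow V"
  unfolding simple_graph_def by auto

lemma simple_graph_finite_edges: "simple_graph V E \<Longrightarrow> finite E"
  by (rule finite_subset[OF simple_graph_edges_Pow]) (auto dest: simple_graph_finite)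

lemma simple_graph_edgeE:
  assumes "simple_graph V E" "e \<in> E"
  obtains u v where "e = {u, v}" "u \<noteq> v" "u \<in> V" "v \<in> V"
  using assms unfolding simple_graph_def by blast

lemma simple_graph_edge_atE:
  assumes "simple_graph V E" "e \<in> E" "u \<in> e"
  obtains v where "e = {u, v}" "u \<noteq> v" "u \<in> V" "v \<in> V"
proof -
  obtain a b where ab: "e = {a, b}" "a \<noteq> b" "a \<in> V" "b \<in> V" by (rule simple_graph_edgeE[OF assms(1,2)])
  show ?thesis
  proof (cases "u = a")
    case True then show ?thesis using that[of b] ab by auto
  next
    case False then show ?thesis using that[of a] ab assms(3) by auto
  qed
qed

lemma simple_graph_subset: "simple_graph V E \<Longrightarrow> E' \<subseteq> E \<Longrightarrow> simple_graph V E'"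
  unfolding simple_graph_def by blast

lemma simple_graph_del: "simple_graph V E \<Longrightarrow> simple_graph (V - S) (del_edges E S)"
  unfolding simple_graph_def del_edges_def by fastforce

lemma del_edges_subset: "del_edges E S \<subseteq> E"
  unfolding del_edges_def by blast

lemma del_edges_Un: "del_edges (del_edges E S) T = del_edges E (S \<union> T)"
  unfolding del_edges_def by blast

lemma doubleton_in_del_edges: "{u, v} \<in> del_edges E S \<longleftrightarrow> {u, v} \<in> E \<and> u \<notin> S \<and> v \<notin> S"
  unfolding del_edges_def by auto

section \<open>Components and the cyclomatic number when edges change\<close>

definition component :: "'a set \<Rightarrow> 'a set set \<Rightarrow> 'a \<Rightarrow> 'a set" where
  "component V E u = {v \<in> V. reach E u v}"

lemma num_components_eq: "num_components V E = card (component V E ` V)"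
proof -
  have "V // connected_rel V E = component V E ` V"
    unfolding quotient_def connected_rel_def component_def reach_def by auto
  then show ?thesis unfolding num_components_def by simp
qed

lemma component_eq_iff:
  assumes "u \<in> V" "v \<in> V"
  shows "component V E u = component V E v \<longleftrightarrow> reach E u v"
proof
  assume "component V E u = component V E v"
  moreover have "v \<in> component V E v" using assms by (simp add: component_def)
  ultimately have "v \<in> component V E u" by simp
  then show "reach E u v" by (simp add: component_def)
next
  assume uv: "reach E u v"
  have "reach E u w \<longleftrightarrow> reach E v w" for w
    using reach_trans[OF uv, of w] reach_trans[OF reach_sym[OF uv], of w] by blast
  then show "component V E u = component V E v" by (simp add: component_def)
qed

lemma reach_insert:
  "reach (insert {a, b} E) u v \<longleftrightarrow>
     reach E u v \<or> (reach E u a \<and> reach E b v) \<or> (reach E u b \<and> reach E a v)" (is "?L \<longleftrightarrow> ?R v")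
proof
  assume ?L
  then show "?R v"
  proof (induction rule: reach_induct)
    case refl show ?case by simp
  next
    case (step x y)
    show ?case
    proof (cases "{x, y} \<in> E")
      case True
      then show ?thesis using step(3) reach_edge reach_trans by metis
    next
      case False
      then have "x = a \<and> y = b \<or> x = b \<and> y = a" using step(2) by (auto simp: doubleton_eq_iff)
      then show ?thesis using step(3) reach_refl reach_trans by metis
    qed
  qed
next
  assume "?R v"
  moreover have "reach (insert {a, b} E) a b" "reach (insert {a, b} E) b a"
    by (auto intro!: reach_edge simp: insert_commute)
  moreover have "reach E x y \<Longrightarrow> reach (insert {a, b} E) x y" for x y by (rule reach_mono) auto
  ultimately show ?L using reach_trans by metis
qed

text \<open>An edge between different components fuses exactly these two classes and leaves the
  others alone.\<close>

lemma num_components_insert: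
  assumes "finite V" "a \<in> V" "b \<in> V"
  shows "int (num_components V (insert {a, b} E)) = int (num_components V E) - (if reach E a b then 0 else 1)"
proof (cases "reach E a b")
  case True
  then have "reach (insert {a, b} E) u v = reach E u v" for u v
    unfolding reach_insert using reach_sym reach_trans by metis
  then have "component V (insert {a, b} E) = component V E" unfolding component_def by auto
  then show ?thesis using True by (simp add: num_components_eq)
next
  case False
  let ?A = "component V E a" and ?B = "component V E b" and ?K = "component V E"
  have inA: "u \<in> ?A \<longleftrightarrow> u \<in> V \<and> reach E u a" and inB: "u \<in> ?B \<longleftrightarrow> u \<in> V \<and> reach E u b" for u
    unfolding component_def by (auto intro: reach_sym)
  have new: "component V (insert {a, b} E) u = (if u \<in> ?A \<union> ?B then ?A \<union> ?B else ?K u)" if "u \<in> V" for u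
  proof (cases "u \<in> ?A \<union> ?B")
    case True
    then have "reach E u a \<or> reach E u b" using inA inB by blast
    moreover have "reach E u = reach E c" if "reach E u c" for c
      using reach_trans[OF that] reach_trans[OF reach_sym[OF that]] by blast
    ultimately have "reach E u = reach E a \<or> reach E u = reach E b" by blast
    then have "v \<in> component V (insert {a, b} E) u \<longleftrightarrow> v \<in> ?A \<union> ?B" for v
      unfolding component_def reach_insert by (elim disjE) auto
    then show ?thesis using True by auto
  next
    case F: False
    then have "\<not> reach E u a" "\<not> reach E u b" using inA inB that by blast+
    then show ?thesis using F unfolding component_def reach_insert by auto
  qed
  have neq: "?A \<noteq> ?B" using component_eq_iff[of a V b E] assms False by blast
  have img: "component V (insert {a, b} E) ` V = insert (?A \<union> ?B) (?K ` V - {?A, ?B})"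
  proof (rule set_eqI, rule iffI)
    fix X assume "X \<in> component V (insert {a, b} E) ` V"
    then obtain u where u: "u \<in> V" "X = component V (insert {a, b} E) u" by blast
    show "X \<in> insert (?A \<union> ?B) (?K ` V - {?A, ?B})"
    proof (cases "u \<in> ?A \<union> ?B")
      case True then show ?thesis using u new by simp
    next
      case F: False
      then have "?K u \<noteq> ?A" "?K u \<noteq> ?B" using inA inB component_eq_iff[of u V] u assms by auto
      then show ?thesis using F u new by simp
    qed
  next
    fix X assume X: "X \<in> insert (?A \<union> ?B) (?K ` V - {?A, ?B})"
    show "X \<in> component V (insert {a, b} E) ` V"
    proof (cases "X = ?A \<union> ?B")
      case True
      have "a \<in> ?A" using assms inA by simp
      then have "component V (insert {a, b} E) a = X" using new[of a] True assms by simp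
      then show ?thesis using assms by blast
    next
      case F: False
      then obtain u where u: "u \<in> V" "X = ?K u" "?K u \<noteq> ?A" "?K u \<noteq> ?B" using X by blast
      then have "u \<notin> ?A \<union> ?B" using inA inB component_eq_iff[of u V] assms by auto
      then have "component V (insert {a, b} E) u = X" using new[of u] u by simp
      then show ?thesis using u by blast
    qed
  qed
  \<comment> \<open>The fused class is not an old one, so two classes are replaced by one and the
    count falls by exactly 1.\<close>
  have notin: "?A \<union> ?B \<notin> ?K ` V - {?A, ?B}"
  proof
    assume "?A \<union> ?B \<in> ?K ` V - {?A, ?B}"
    then obtain w where w: "w \<in> V" "?A \<union> ?B = ?K w" "?K w \<noteq> ?A" by auto
    have "a \<in> ?K w" using w(2) assms inA by auto
    then have "?K w = ?A" using component_eq_iff[of w V a E] w assms unfolding component_def by blast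
    then show False using w by blast
  qed
  have "card (component V (insert {a, b} E) ` V) = Suc (card (?K ` V - {?A, ?B}))"
    unfolding img using notin assms(1) by (subst card_insert_disjoint) auto
  moreover have "card (?K ` V) = Suc (Suc (card (?K ` V - {?A, ?B})))"
  proof -
    have "?K ` V = insert ?A (insert ?B (?K ` V - {?A, ?B}))" using assms by auto
    then have "card (?K ` V) = card (insert ?A (insert ?B (?K ` V - {?A, ?B})))" by (rule arg_cong)
    also have "\<dots> = Suc (Suc (card (?K ` V - {?A, ?B})))"
      using neq assms(1) by (subst card_insert_disjoint; (subst card_insert_disjoint)?) auto
    finally show ?thesis .
  qed
  ultimately show ?thesis using False by (simp add: num_components_eq)
qed

text \<open>When a graph is built edge by edge, \<open>theta\<close> counts the edges whose ends
  were already connected. Monotonicity, nonnegativity and the detection of cycles rest on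
  this.\<close>

lemma theta_insert:
  assumes "finite V" "finite E" "a \<in> V" "b \<in> V" "{a, b} \<notin> E"
  shows "theta V (insert {a, b} E) = theta V E + (if reach E a b then 1 else 0)"
  unfolding theta_def num_components_insert[OF assms(1,3,4)] using assms by simp

lemma theta_empty: "theta V {} = 0"
proof -
  have "reach {} u v \<longleftrightarrow> u = v" for u v :: 'a unfolding reach_def by simp
  then have "component V {} u = {u}" if "u \<in> V" for u unfolding component_def using that by auto
  then have "component V {} ` V = (\<lambda>u. {u}) ` V" by (rule image_cong[OF refl])
  then show ?thesis unfolding theta_def num_components_eq by (simp add: card_image)
qed

lemma theta_mono:
  assumes "simple_graph V E" "E' \<subseteq> E"
  shows "theta V E' \<le> theta V E"
proof -
  have "theta V E' \<le> theta V (E' \<union> D)" if "finite D" "D \<subseteq> E" for D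
    using that
  proof (induction D rule: finite_induct)
    case empty then show ?case by simp
  next
    case (insert e D)
    obtain a b where ab: "e = {a, b}" "a \<in> V" "b \<in> V"
      using insert assms by (meson insert_subset simple_graph_edgeE)
    have fin: "finite (E' \<union> D)"
      using assms insert simple_graph_finite_edges finite_subset by blast
    have "theta V (E' \<union> D) \<le> theta V (insert e (E' \<union> D))"
    proof (cases "e \<in> E' \<union> D")
      case True then show ?thesis by (simp add: insert_absorb)
    next
      case False
      then show ?thesis unfolding ab
        using theta_insert[OF simple_graph_finite[OF assms(1)] fin ab(2,3)] ab(1) by auto
    qed
    then show ?case using insert by simp
  qed
  from this[of E] assms simple_graph_finite_edges have "theta V E' \<le> theta V (E' \<union> E)" by blast
  moreover have "E' \<union> E = E" using assms by blast
  ultimately show ?thesis by simp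
qed

lemma theta_nonneg: "simple_graph V E \<Longrightarrow> 0 \<le> theta V E"
  using theta_mono[of V E "{}"] by (simp add: theta_empty)

lemma theta_remove_edge:
  assumes "simple_graph V E" "{a, b} \<in> E" "reach (E - {{a, b}}) a b"
  shows "theta V (E - {{a, b}}) = theta V E - 1"
proof -
  have "insert {a, b} (E - {{a, b}}) = E" using assms by blast
  then show ?thesis
    using theta_insert[of V "E - {{a, b}}" a b] assms simple_graph_finite[OF assms(1)]
      simple_graph_finite_edges[OF assms(1)] simple_graphD[OF assms(1,2)] by simp
qed

text \<open>An isolated vertex is a component of its own, so the order and the number of components
  fall together.\<close>

lemma theta_remove_isolated:
  assumes "finite V" "x \<in> V" "\<And>e. e \<in> E \<Longrightarrow> x \<notin> e"
  shows "theta (V - {x}) E = theta V E"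
proof -
  have x: "v = x" if "reach E x v" for v
    using that by (induction rule: reach_induct) (use assms(3) in auto)
  have comp: "component (V - {x}) E u = component V E u" if "u \<in> V - {x}" for u
    unfolding component_def using x[OF reach_sym] that by auto
  have compx: "component V E x = {x}" unfolding component_def using x assms by auto
  have "component V E ` V = insert {x} (component (V - {x}) E ` (V - {x}))"
  proof -
    have "component V E ` V = insert (component V E x) (component V E ` (V - {x}))" using assms(2) by blast
    also have "component V E ` (V - {x}) = component (V - {x}) E ` (V - {x})"
      by (rule image_cong[OF refl]) (simp add: comp)
    finally show ?thesis using compx by simp
  qed
  moreover have "{x} \<notin> component (V - {x}) E ` (V - {x})" unfolding component_def by auto
  ultimately have "num_components V E = Suc (num_components (V - {x}) E)"
    unfolding num_components_eq using assms(1) by simp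
  moreover have "card V = Suc (card (V - {x}))" by (rule card.remove[OF assms(1,2)])
  ultimately show ?thesis unfolding theta_def by simp
qed

lemma theta_remove_isolated_set:
  assumes "finite V" "S \<subseteq> V" "\<And>e. e \<in> E \<Longrightarrow> e \<inter> S = {}"
  shows "theta (V - S) E = theta V E"
proof -
  have "finite S" using assms finite_subset by blast
  then show ?thesis using assms(2,3)
  proof (induction S rule: finite_induct)
    case empty then show ?case by simp
  next
    case (insert x S)
    have "V - insert x S = V - S - {x}" by blast
    moreover have "theta (V - S - {x}) E = theta (V - S) E"
      by (rule theta_remove_isolated) (use insert assms(1) in auto)
    ultimately show ?case using insert by auto
  qed
qed

lemma theta_del_eq:
  assumes "simple_graph V E" "S \<subseteq> V"
  shows "theta (V - S) (del_edges E S) = theta V (del_edges E S)"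
  by (rule theta_remove_isolated_set) (use assms simple_graph_finite in \<open>auto simp: del_edges_def\<close>)

lemma theta_del_le:
  assumes "simple_graph V E" "S \<subseteq> V"
  shows "theta (V - S) (del_edges E S) \<le> theta V E"
  using theta_del_eq[OF assms] theta_mono[OF assms(1) del_edges_subset] by simp

text \<open>Adding the edges one at a time to the empty graph, some edge must raise
  \<open>theta\<close>. Its ends are connected by edges already present, and edges added later do
  not destroy this connection.\<close>

lemma theta_pos_nonbridge:
  assumes "simple_graph V E" "theta V E > 0"
  obtains a b where "{a, b} \<in> E" "reach (E - {{a, b}}) a b"
proof -
  have "\<exists>a b. {a, b} \<in> D \<and> reach (D - {{a, b}}) a b" if "finite D" "D \<subseteq> E" "theta V D > 0" for D
    using that
  proof (induction D rule: finite_induct)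
    case empty then show ?case by (simp add: theta_empty)
  next
    case (insert e D)
    obtain a b where ab: "e = {a, b}" "a \<in> V" "b \<in> V"
      using insert assms by (meson insert_subset simple_graph_edgeE)
    show ?case
    proof (cases "reach D a b")
      case True
      moreover have "insert e D - {{a, b}} = D" using insert(2) ab by blast
      ultimately show ?thesis using ab(1) by (intro exI[of _ a] exI[of _ b]) simp
    next
      case False
      then have "theta V D > 0"
        using insert theta_insert[OF simple_graph_finite[OF assms(1)] insert(1) ab(2,3)] ab(1) by simp
      then obtain c d where cd: "{c, d} \<in> D" "reach (D - {{c, d}}) c d" using insert by blast
      then have "reach (insert e D - {{c, d}}) c d" by (elim reach_mono) blast
      then show ?thesis using cd by blast
    qed
  qed
  from this[OF simple_graph_finite_edges[OF assms(1)] order_refl assms(2)] show ?thesis using that by blast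
qed

section \<open>Paths, cycles and cyclic indexing\<close>

lemma reach_path:
  assumes "reach E u v"
  shows "\<exists>xs. xs \<noteq> [] \<and> hd xs = u \<and> last xs = v \<and> distinct xs \<and>
           (\<forall>i. Suc i < length xs \<longrightarrow> {xs ! i, xs ! Suc i} \<in> E)"
  using assms
proof (induction rule: reach_induct)
  case refl
  show ?case by (rule exI[of _ "[u]"]) simp
next
  case (step y z)
  then obtain xs where xs: "xs \<noteq> []" "hd xs = u" "last xs = y" "distinct xs"
    and edge: "\<And>i. Suc i < length xs \<Longrightarrow> {xs ! i, xs ! Suc i} \<in> E" by blast
  show ?case
  proof (cases "z \<in> set xs")
    case True
    then obtain j where j: "j < length xs" "xs ! j = z" by (auto simp: in_set_conv_nth)
    \<comment> \<open>When the walk returns to a vertex of the path, cutting the path there keeps it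
      simple.\<close>
    have "last (take (Suc j) xs) = z" using j by (simp add: take_Suc_conv_app_nth)
    then show ?thesis using xs edge j by (intro exI[of _ "take (Suc j) xs"]) auto
  next
    case False
    have "{(xs @ [z]) ! i, (xs @ [z]) ! Suc i} \<in> E" if "Suc i < length (xs @ [z])" for i
    proof (cases "Suc i < length xs")
      case True then show ?thesis using edge by (simp add: nth_append)
    next
      case F: False
      then have "i = length xs - 1" "Suc i = length xs" using that by auto
      then show ?thesis using step(2) xs by (simp add: nth_append last_conv_nth)
    qed
    then show ?thesis using xs False by (intro exI[of _ "xs @ [z]"]) auto
  qed
qed

lemma nonbridge_on_cycle:
  assumes "{a, b} \<in> E" "a \<noteq> b" "reach (E - {{a, b}}) a b"
  obtains C where "C \<in> cycles E" "{a, b} \<in> C"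
proof -
  obtain xs where xs: "xs \<noteq> []" "hd xs = a" "last xs = b" "distinct xs"
    and edge: "\<And>i. Suc i < length xs \<Longrightarrow> {xs ! i, xs ! Suc i} \<in> E - {{a, b}}"
    using reach_path[OF assms(3)] by blast
  have 0: "xs ! 0 = a" using xs by (simp add: hd_conv_nth)
  have l: "xs ! (length xs - 1) = b" using xs by (simp add: last_conv_nth)
  have "length xs \<noteq> 1" using 0 l assms(2) by auto
  \<comment> \<open>A path on two vertices would be the removed edge \<open>{a, b}\<close>
    itself.\<close>
  moreover have "length xs \<noteq> 2" using edge[of 0] 0 l by auto
  moreover have "length xs \<noteq> 0" using xs by simp
  ultimately have len: "length xs \<ge> 3" by linarith
  have "{xs ! i, xs ! ((i + 1) mod length xs)} \<in> E" if "i < length xs" for i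
  proof (cases "Suc i < length xs")
    case True then show ?thesis using edge[of i] by simp
  next
    case False
    then have "Suc i = length xs" using that by simp
    then show ?thesis using 0 l assms(1) by (simp add: insert_commute flip: \<open>Suc i = length xs\<close>)
  qed
  then have "cycle_list E xs" unfolding cycle_list_def using xs len by blast
  moreover have "{a, b} \<in> cycle_edges xs"
    unfolding cycle_edges_def
  proof (intro CollectI exI[of _ "length xs - 1"] conjI)
    have "length xs - 1 + 1 = length xs" using len by linarith
    then have "(length xs - 1 + 1) mod length xs = 0" by (metis mod_self)
    then show "{a, b} = {xs ! (length xs - 1), xs ! ((length xs - 1 + 1) mod length xs)}"
      using 0 l by (simp add: insert_commute)
  qed (use len in auto)
  ultimately show ?thesis using that unfolding cycles_def by blast
qed

text \<open>Reducing the index modulo the length lets walks run around the cycle several times, with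
  no case split at the closing edge.\<close>

definition cyc_nth :: "'a list \<Rightarrow> nat \<Rightarrow> 'a" where
  "cyc_nth vs i = vs ! (i mod length vs)"

lemma cyc_nth_eq_iff:
  assumes "distinct vs" "vs \<noteq> []"
  shows "cyc_nth vs i = cyc_nth vs j \<longleftrightarrow> i mod length vs = j mod length vs"
  unfolding cyc_nth_def using assms by (simp add: nth_eq_iff_index_eq)

text \<open>A crosswise match of the end points would make \<open>i\<close> and \<open>i + 2\<close>
  congruent modulo the length, which length at least 3 excludes.\<close>

lemma cyc_nth_edge_eq_iff:
  assumes "distinct vs" "length vs \<ge> 3"
  shows "{cyc_nth vs i, cyc_nth vs (Suc i)} = {cyc_nth vs j, cyc_nth vs (Suc j)} \<longleftrightarrow>
    i mod length vs = j mod length vs"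
proof -
  have ne: "vs \<noteq> []" using assms by auto
  show ?thesis
    unfolding doubleton_eq_iff cyc_nth_eq_iff[OF assms(1) ne] mod_Suc using assms(2) by auto
qed

lemma cycle_edges_cyc_nth:
  assumes "vs \<noteq> []"
  shows "cycle_edges vs = range (\<lambda>i. {cyc_nth vs i, cyc_nth vs (Suc i)})"
proof (rule set_eqI, rule iffI)
  fix e assume "e \<in> cycle_edges vs"
  then obtain i where "i < length vs" "e = {vs ! i, vs ! ((i + 1) mod length vs)}"
    unfolding cycle_edges_def by blast
  then show "e \<in> range (\<lambda>i. {cyc_nth vs i, cyc_nth vs (Suc i)})" unfolding cyc_nth_def by (intro image_eqI[of _ _ i]) auto
next
  fix e assume "e \<in> range (\<lambda>i. {cyc_nth vs i, cyc_nth vs (Suc i)})"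
  then obtain i where "e = {cyc_nth vs i, cyc_nth vs (Suc i)}" by blast
  then show "e \<in> cycle_edges vs" unfolding cycle_edges_def cyc_nth_def
    using assms by (intro CollectI exI[of _ "i mod length vs"]) (auto simp: mod_Suc_eq)
qed

lemma cycle_list_iff: "cycle_list E vs \<longleftrightarrow> distinct vs \<and> length vs \<ge> 3 \<and> cycle_edges vs \<subseteq> E"
  unfolding cycle_list_def cycle_edges_def by blast

lemma cyc_nth_in_set: "vs \<noteq> [] \<Longrightarrow> cyc_nth vs i \<in> set vs"
  unfolding cyc_nth_def by simp

lemma in_set_cyc_nth: "x \<in> set vs \<Longrightarrow> \<exists>i<length vs. x = cyc_nth vs i"
  unfolding cyc_nth_def in_set_conv_nth by auto

lemma cyc_verts_cycle_edges:
  assumes "vs \<noteq> []" shows "cyc_verts (cycle_edges vs) = set vs"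
  unfolding cyc_verts_def cycle_edges_cyc_nth[OF assms]
  using cyc_nth_in_set[OF assms] in_set_cyc_nth by fastforce

lemma cyclesE:
  assumes "C \<in> cycles E"
  obtains vs where "distinct vs" "length vs \<ge> 3" "C = cycle_edges vs" "C \<subseteq> E" "cyc_verts C = set vs" "vs \<noteq> []"
proof -
  obtain vs where vs: "cycle_list E vs" "C = cycle_edges vs" using assms unfolding cycles_def by blast
  then have "vs \<noteq> []" unfolding cycle_list_def by auto
  then show ?thesis using that[of vs] vs cyc_verts_cycle_edges unfolding cycle_list_iff by blast
qed

text \<open>Being a cycle is a property of the edge set alone, so passing to subgraphs and
  supergraphs is a matter of inclusion.\<close>

lemma cycles_iff: "C \<in> cycles E \<longleftrightarrow> C \<in> cycles C \<and> C \<subseteq> E"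
  unfolding cycles_def cycle_list_iff by blast

lemma cycles_mono: "E \<subseteq> E' \<Longrightarrow> cycles E \<subseteq> cycles E'"
  using cycles_iff by blast

lemma cycles_subset: "C \<in> cycles E \<Longrightarrow> C \<subseteq> E"
  using cycles_iff by blast

lemma reach_cyc_nth:
  assumes "distinct vs" "length vs \<ge> 3" "k < length vs"
  shows "reach (cycle_edges vs - {{cyc_nth vs i, cyc_nth vs (Suc i)}}) (cyc_nth vs (Suc i)) (cyc_nth vs (Suc i + k))"
  using assms(3)
proof (induction k)
  case 0 then show ?case by simp
next
  case (Suc k)
  have ne: "vs \<noteq> []" using assms by auto
  let ?j = "Suc i + k"
  have "{cyc_nth vs ?j, cyc_nth vs (Suc ?j)} \<in> cycle_edges vs" unfolding cycle_edges_cyc_nth[OF ne] by blast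
  \<comment> \<open>The walk starts just behind edge number \<open>i\<close>, so with fewer than
    \<open>length vs\<close> steps it never uses that edge.\<close>
  moreover have "?j mod length vs \<noteq> i mod length vs"
  proof
    assume "?j mod length vs = i mod length vs"
    then have "length vs dvd ?j - i" by (metis mod_eq_dvd_iff_nat le_add1 add_Suc add_Suc_right)
    then have "length vs dvd Suc k" by (simp add: Suc_diff_le)
    then show False using Suc(2) by (auto dest: dvd_imp_le)
  qed
  ultimately have "reach (cycle_edges vs - {{cyc_nth vs i, cyc_nth vs (Suc i)}}) (cyc_nth vs ?j) (cyc_nth vs (Suc ?j))"
    by (intro reach_edge) (simp add: cyc_nth_edge_eq_iff[OF assms(1,2)])
  then show ?case using Suc reach_trans by fastforce
qed

lemma cycle_edge_nonbridge:
  assumes "C \<in> cycles E" "{a, b} \<in> C"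
  shows "reach (C - {{a, b}}) a b"
proof -
  obtain vs where vs: "distinct vs" "length vs \<ge> 3" "C = cycle_edges vs" "vs \<noteq> []"
    by (rule cyclesE[OF assms(1)])
  obtain i where i: "{a, b} = {cyc_nth vs i, cyc_nth vs (Suc i)}"
    using assms(2) vs cycle_edges_cyc_nth by blast
  \<comment> \<open>One step less than a full turn leads from one end of the edge to the other
    without crossing it.\<close>
  have "cyc_nth vs (Suc i + (length vs - 1)) = cyc_nth vs i"
    using vs unfolding cyc_nth_def by (simp add: Suc_diff_le)
  then have "reach (C - {{a, b}}) (cyc_nth vs (Suc i)) (cyc_nth vs i)"
    using reach_cyc_nth[OF vs(1,2), of "length vs - 1" i] vs unfolding i by simp
  then show ?thesis using i by (metis doubleton_eq_iff reach_sym)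
qed

lemma reach_within_cycle:
  assumes "C \<in> cycles E" "x \<in> cyc_verts C" "y \<in> cyc_verts C"
  shows "reach C x y"
proof -
  obtain vs where vs: "distinct vs" "length vs \<ge> 3" "C = cycle_edges vs" "cyc_verts C = set vs" "vs \<noteq> []"
    by (rule cyclesE[OF assms(1)])
  have "reach C (cyc_nth vs 0) (cyc_nth vs i)" for i
  proof (induction i)
    case 0 show ?case by simp
  next
    case (Suc i)
    have "{cyc_nth vs i, cyc_nth vs (Suc i)} \<in> C" using vs cycle_edges_cyc_nth by blast
    then show ?case using Suc reach_edge reach_trans by metis
  qed
  then show ?thesis using assms(2,3) in_set_cyc_nth reach_sym reach_trans unfolding vs(4) by metis
qed

lemma cycle_edgeE:
  assumes "C \<in> cycles E" "e \<in> C" "x \<in> e" "simple_graph V E"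
  obtains y where "e = {x, y}" "x \<noteq> y" "reach (C - {e}) x y"
proof -
  obtain y where "e = {x, y}" "x \<noteq> y"
    by (rule simple_graph_edge_atE[OF assms(4) _ assms(3)]) (use assms cycles_subset in blast)
  then show ?thesis using that cycle_edge_nonbridge assms by metis
qed

text \<open>A cycle edge at \<open>x\<close> is not a bridge, so its removal alone lowers
  \<open>theta\<close> by 1, and deleting the remaining edges at \<open>x\<close> cannot raise it
  again.\<close>

lemma theta_delete_cycle_vertex:
  assumes "simple_graph V E" "C \<in> cycles E" "x \<in> cyc_verts C"
  shows "theta (V - {x}) (del_edges E {x}) \<le> theta V E - 1"
proof -
  obtain e where e: "e \<in> C" "x \<in> e" using assms(3) unfolding cyc_verts_def by blast
  obtain y where y: "e = {x, y}" "x \<noteq> y" "reach (C - {e}) x y" by (rule cycle_edgeE[OF assms(2) e assms(1)])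
  have eE: "{x, y} \<in> E" using e y assms cycles_subset by blast
  have "reach (E - {e}) x y" using y(3) by (rule reach_mono) (use assms cycles_subset in blast)
  then have "theta V (E - {e}) = theta V E - 1" using theta_remove_edge[OF assms(1) eE] y by simp
  moreover have "theta V (del_edges E {x}) \<le> theta V (E - {e})"
    by (rule theta_mono[OF simple_graph_subset[OF assms(1)]]) (use e in \<open>auto simp: del_edges_def\<close>)
  ultimately show ?thesis using theta_del_eq[OF assms(1), of "{x}"] simple_graphD[OF assms(1) eE] by simp
qed

text \<open>An edge of \<open>C1\<close> outside \<open>C2\<close> that touches \<open>C2\<close> at
  \<open>x\<close> is removed first, which costs 1 and leaves \<open>C2\<close> intact; deleting
  \<open>x\<close>, a vertex of \<open>C2\<close>, then costs at least 1 more.\<close>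

lemma theta_delete_shared_vertex:
  assumes "simple_graph V E" "C1 \<in> cycles E" "C2 \<in> cycles E" "\<not> C1 \<subseteq> C2" "cyc_verts C1 \<inter> cyc_verts C2 \<noteq> {}"
  obtains x where "x \<in> cyc_verts C1" "theta (V - {x}) (del_edges E {x}) \<le> theta V E - 2"
proof -
  obtain z where z: "z \<in> cyc_verts C1" "z \<in> cyc_verts C2" using assms(5) by blast
  \<comment> \<open>Otherwise a walk along \<open>C1\<close> from the common vertex could never
    leave \<open>C2\<close>, and \<open>C1\<close> would be contained in it.\<close>
  have "\<exists>x\<in>cyc_verts C2. \<exists>e\<in>C1 - C2. x \<in> e"
  proof (rule ccontr)
    assume neg: "\<not> ?thesis"
    have "v \<in> cyc_verts C2" if v: "v \<in> cyc_verts C1" for v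
      using reach_within_cycle[OF assms(2) z(1) v] z(2)
    proof (rule reach_closed)
      fix a b assume ab: "a \<in> cyc_verts C2" "{a, b} \<in> C1"
      then have "{a, b} \<in> C2" using neg by blast
      then show "b \<in> cyc_verts C2" unfolding cyc_verts_def by blast
    qed
    moreover have "e \<subseteq> cyc_verts C1 \<and> e \<noteq> {}" if "e \<in> C1" for e
    proof -
      have "e \<in> E" using that assms cycles_subset by blast
      then show ?thesis using that simple_graph_edgeE[OF assms(1)] unfolding cyc_verts_def by blast
    qed
    ultimately have "C1 \<subseteq> C2" using neg by blast
    then show False using assms by blast
  qed
  then obtain x e where x: "x \<in> cyc_verts C2" "x \<in> e" "e \<in> C1" "e \<notin> C2" by blast
  obtain y where y: "e = {x, y}" "x \<noteq> y" "reach (C1 - {e}) x y" by (rule cycle_edgeE[OF assms(2) x(3,2) assms(1)])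
  have eE: "{x, y} \<in> E" using x y assms cycles_subset by blast
  have "reach (E - {e}) x y" using y(3) by (rule reach_mono) (use assms cycles_subset in blast)
  then have 1: "theta V (E - {e}) = theta V E - 1" using theta_remove_edge[OF assms(1) eE] y by simp
  have "C2 \<in> cycles (E - {e})" using assms(3) x cycles_iff by blast
  from theta_delete_cycle_vertex[OF simple_graph_subset[OF assms(1)] this x(1)] 1
  have "theta (V - {x}) (del_edges (E - {e}) {x}) \<le> theta V E - 2" by auto
  moreover have "del_edges (E - {e}) {x} = del_edges E {x}" using x unfolding del_edges_def by blast
  moreover have "x \<in> cyc_verts C1" using x unfolding cyc_verts_def by blast
  ultimately show ?thesis using that by metis
qed

lemma theta_pos_cycle:
  assumes "simple_graph V E" "theta V E > 0"
  obtains C where "C \<in> cycles E"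
proof -
  obtain a b where ab: "{a, b} \<in> E" "reach (E - {{a, b}}) a b" by (rule theta_pos_nonbridge[OF assms])
  show ?thesis by (rule nonbridge_on_cycle[OF ab(1) _ ab(2)]) (use simple_graphD[OF assms(1) ab(1)] that in auto)
qed

lemma handshake:
  assumes "simple_graph V E"
  shows "(\<Sum>v\<in>V. card {e \<in> E. v \<in> e}) = 2 * card E"
proof -
  have fin: "finite V" "finite E" using assms simple_graph_finite simple_graph_finite_edges by auto
  have "(\<Sum>v\<in>V. card {e \<in> E. v \<in> e}) = (\<Sum>v\<in>V. \<Sum>e\<in>E. if v \<in> e then 1 else 0)"
    by (rule sum.cong[OF refl]) (use fin in \<open>simp add: sum.If_cases Int_def\<close>)
  also have "\<dots> = (\<Sum>e\<in>E. \<Sum>v\<in>V. if v \<in> e then 1 else 0)" by (rule sum.swap)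
  also have "\<dots> = (\<Sum>e\<in>E. 2)"
  proof (rule sum.cong[OF refl])
    fix e assume "e \<in> E"
    then obtain a b where ab: "e = {a, b}" "a \<noteq> b" "a \<in> V" "b \<in> V" using simple_graph_edgeE[OF assms] by metis
    have "(\<Sum>v\<in>V. if v \<in> e then 1 else 0) = card (V \<inter> e)" using fin by (simp add: sum.If_cases Int_def)
    also have "V \<inter> e = {a, b}" using ab by blast
    finally show "(\<Sum>v\<in>V. if v \<in> e then 1 else (0::nat)) = 2" using ab by simp
  qed
  finally show ?thesis by simp
qed

lemma num_components_pos: "finite V \<Longrightarrow> V \<noteq> {} \<Longrightarrow> 0 < num_components V E"
  unfolding num_components_eq by (simp add: card_gt_0_iff)

text \<open>With \<open>theta\<close> zero and at least one component there are fewer edges than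
  vertices, so the average degree is below 2.\<close>

lemma theta_zero_leaf:
  assumes "simple_graph V E" "theta V E = 0" "V \<noteq> {}"
  obtains v where "v \<in> V" "card {e \<in> E. v \<in> e} \<le> 1"
proof -
  have fin: "finite V" using assms simple_graph_finite by auto
  have "card E < card V" using assms(2) num_components_pos[OF fin assms(3), of E] unfolding theta_def by linarith
  have "\<exists>v\<in>V. card {e \<in> E. v \<in> e} \<le> 1"
  proof (rule ccontr)
    assume "\<not> ?thesis"
    then have "(\<Sum>v\<in>V. 2) \<le> (\<Sum>v\<in>V. card {e \<in> E. v \<in> e})" by (intro sum_mono) force
    then show False using \<open>card E < card V\<close> handshake[OF assms(1)] by simp
  qed
  then show ?thesis using that by blast
qed

section \<open>The rank bound and its extremal graphs\<close>

lemma gain_graph_simple: "gain_graph V E \<phi> \<Longrightarrow> simple_graph V E"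
  unfolding gain_graph_def by blast

lemma gain_graph_one: "simple_graph V E \<Longrightarrow> gain_graph V E (\<lambda>_ _. 1)"
  unfolding gain_graph_def by simp

lemma gain_graph_del: "gain_graph V E \<phi> \<Longrightarrow> gain_graph (V - S) (del_edges E S) \<phi>"
  using simple_graph_del del_edges_subset unfolding gain_graph_def by blast

lemma gain_graph_edge:
  assumes "gain_graph V E \<phi>" "{u, v} \<in> E"
  shows "norm (\<phi> u v) = 1" "\<phi> v u = cnj (\<phi> u v)"
proof -
  from assms(1) have "\<forall>u v. {u, v} \<in> E \<longrightarrow> norm (\<phi> u v) = 1 \<and> \<phi> v u = cnj (\<phi> u v)"
    unfolding gain_graph_def by (rule conjunct2)
  from this[rule_format, OF assms(2)] show "norm (\<phi> u v) = 1" "\<phi> v u = cnj (\<phi> u v)"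
    by (rule conjunct1, rule conjunct2)
qed

lemma gain_graph_hermitian:
  assumes "gain_graph V E \<phi>" shows "hermitian_on W (gain_adj_mat E \<phi>)"
  unfolding hermitian_on_def
proof (intro ballI)
  fix u v
  show "gain_adj_mat E \<phi> v u = cnj (gain_adj_mat E \<phi> u v)"
  proof (cases "{u, v} \<in> E")
    case True
    moreover from this have "{v, u} \<in> E" by (simp add: insert_commute)
    ultimately show ?thesis using gain_graph_edge(2)[OF assms True] unfolding gain_adj_mat_def by simp
  next
    case False
    moreover from this have "{v, u} \<notin> E" by (simp add: insert_commute)
    ultimately show ?thesis unfolding gain_adj_mat_def by simp
  qed
qed

lemma gain_rank_del: "gain_rank (V - S) (del_edges E S) \<phi> = mat_rank (V - S) (gain_adj_mat E \<phi>)"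
  unfolding gain_rank_def
  by (rule mat_rank_cong) (simp add: gain_adj_mat_def doubleton_in_del_edges)

lemma gain_rank_del_le:
  "gain_graph V E \<phi> \<Longrightarrow> gain_rank (V - {x}) (del_edges E {x}) \<phi> \<le> gain_rank V E \<phi>"
  unfolding gain_rank_del unfolding gain_rank_def
  by (rule mat_rank_delete_le) (simp add: gain_graph_def simple_graph_def)

lemma gain_rank_le_del:
  "gain_graph V E \<phi> \<Longrightarrow> gain_rank V E \<phi> \<le> gain_rank (V - {x}) (del_edges E {x}) \<phi> + 2"
  unfolding gain_rank_del unfolding gain_rank_def
  by (rule mat_rank_le_delete) (simp add: gain_graph_def simple_graph_def)

lemma gain_rank_isolated:
  assumes "gain_graph V E \<phi>" "v \<in> V" "\<And>e. e \<in> E \<Longrightarrow> v \<notin> e"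
  shows "gain_rank V E \<phi> = gain_rank (V - {v}) (del_edges E {v}) \<phi>"
  unfolding gain_rank_del unfolding gain_rank_def
  by (rule mat_rank_delete_isolated[symmetric])
    (use assms gain_graph_hermitian[OF assms(1)] in \<open>auto simp: gain_adj_mat_def gain_graph_def simple_graph_def\<close>)

lemma gain_rank_pendant:
  assumes "gain_graph V E \<phi>" "{u, v} \<in> E" "\<And>e. e \<in> E \<Longrightarrow> v \<in> e \<Longrightarrow> e = {u, v}"
  shows "gain_rank V E \<phi> = gain_rank (V - {u, v}) (del_edges E {u, v}) \<phi> + 2"
  unfolding gain_rank_del unfolding gain_rank_def
proof (rule mat_rank_delete_pendant)
  note sg = gain_graph_simple[OF assms(1)]
  show "finite V" using simple_graph_finite[OF sg] .
  show "hermitian_on V (gain_adj_mat E \<phi>)" by (rule gain_graph_hermitian[OF assms(1)])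
  show "u \<in> V" "v \<in> V" "u \<noteq> v" using simple_graphD[OF sg assms(2)] by auto
  have vu: "{v, u} \<in> E" using assms(2) by (simp add: insert_commute)
  then have "norm (\<phi> v u) = 1" by (rule gain_graph_edge(1)[OF assms(1)])
  then show "gain_adj_mat E \<phi> v u \<noteq> 0" using vu unfolding gain_adj_mat_def by auto
  fix w assume "w \<noteq> u"
  then have "{v, w} \<notin> E" using assms(3)[of "{v, w}"] by (auto simp: doubleton_eq_iff)
  then show "gain_adj_mat E \<phi> v w = 0" unfolding gain_adj_mat_def by simp
qed

lemma graph_rank_le_del:
  "simple_graph V E \<Longrightarrow> graph_rank V E \<le> graph_rank (V - {x}) (del_edges E {x}) + 2"
  unfolding graph_rank_eq_gain_rank by (rule gain_rank_le_del[OF gain_graph_one])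

lemma graph_rank_isolated:
  assumes "simple_graph V E" "v \<in> V" "\<And>e. e \<in> E \<Longrightarrow> v \<notin> e"
  shows "graph_rank V E = graph_rank (V - {v}) (del_edges E {v})"
  unfolding graph_rank_eq_gain_rank by (rule gain_rank_isolated[OF gain_graph_one[OF assms(1)] assms(2,3)])

lemma graph_rank_pendant:
  assumes "simple_graph V E" "{u, v} \<in> E" "\<And>e. e \<in> E \<Longrightarrow> v \<in> e \<Longrightarrow> e = {u, v}"
  shows "graph_rank V E = graph_rank (V - {u, v}) (del_edges E {u, v}) + 2"
  unfolding graph_rank_eq_gain_rank by (rule gain_rank_pendant[OF gain_graph_one[OF assms(1)] assms(2,3)])

lemma degree_le_1_cases:
  assumes "simple_graph V E" "card {e \<in> E. v \<in> e} \<le> 1"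
  obtains (isolated) "\<And>e. e \<in> E \<Longrightarrow> v \<notin> e"
    | (pendant) u where "{u, v} \<in> E" "\<And>e. e \<in> E \<Longrightarrow> v \<in> e \<Longrightarrow> e = {u, v}"
proof (cases "{e \<in> E. v \<in> e} = {}")
  case True
  show ?thesis by (rule isolated) (use True in auto)
next
  case False
  then have "card {e \<in> E. v \<in> e} = 1"
    using assms simple_graph_finite_edges[OF assms(1)] by (auto simp add: le_Suc_eq)
  then obtain e0 where e0: "{e \<in> E. v \<in> e} = {e0}" by (rule card_1_singletonE)
  then have "e0 \<in> E" "v \<in> e0" by auto
  then obtain u where "e0 = {v, u}" by (rule simple_graph_edge_atE[OF assms(1)])
  then have uv: "e0 = {u, v}" by (simp only: insert_commute)
  show ?thesis
  proof (rule pendant)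
    show "{u, v} \<in> E" using \<open>e0 \<in> E\<close> uv by simp
    show "e = {u, v}" if "e \<in> E" "v \<in> e" for e
      using that e0 uv by blast
  qed
qed

lemma card_del_less:
  assumes "simple_graph V E" "x \<in> V" "x \<in> S"
  shows "card (V - S) < card V"
  by (rule psubset_card_mono) (use assms simple_graph_finite in auto)

text \<open>Peeling an isolated vertex or a pendant pair changes the rank by 0 or 2, whatever the
  gains are.\<close>

lemma forest_gain_rank:
  assumes "gain_graph V E \<phi>" "theta V E = 0"
  shows "gain_rank V E \<phi> = graph_rank V E"
  using assms
proof (induction "card V" arbitrary: V E rule: less_induct)
  case less
  note sg = gain_graph_simple[OF less.prems(1)]
  have th: "theta (V - S) (del_edges E S) = 0" if "S \<subseteq> V" for S
    using theta_del_le[OF sg that] theta_nonneg[OF simple_graph_del[OF sg], of S] less.prems(2) by linarith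
  show ?case
  proof (cases "V = {}")
    case True
    then show ?thesis unfolding gain_rank_def graph_rank_def mat_rank_def cols_lin_indep_def by simp
  next
    case False
    obtain v where v: "v \<in> V" "card {e \<in> E. v \<in> e} \<le> 1"
      by (rule theta_zero_leaf[OF sg less.prems(2) False])
    from sg v(2) show ?thesis
    proof (cases rule: degree_le_1_cases)
      case isolated
      have "gain_rank (V - {v}) (del_edges E {v}) \<phi> = graph_rank (V - {v}) (del_edges E {v})"
        by (rule less.hyps[OF card_del_less[OF sg v(1)] gain_graph_del[OF less.prems(1)] th]) (use v in auto)
      then show ?thesis
        using gain_rank_isolated[OF less.prems(1) v(1) isolated] graph_rank_isolated[OF sg v(1) isolated] by simp
    next
      case (pendant u)
      have "gain_rank (V - {u, v}) (del_edges E {u, v}) \<phi> = graph_rank (V - {u, v}) (del_edges E {u, v})"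
        by (rule less.hyps[OF card_del_less[OF sg v(1)] gain_graph_del[OF less.prems(1)] th])
          (use simple_graphD[OF sg pendant(1)] in auto)
      then show ?thesis
        using gain_rank_pendant[OF less.prems(1) pendant] graph_rank_pendant[OF sg pendant] by simp
    qed
  qed
qed

lemma gain_rank_lower_bound:
  assumes "gain_graph V E \<phi>"
  shows "int (graph_rank V E) - 2 * theta V E \<le> int (gain_rank V E \<phi>)"
  using assms
proof (induction "card V" arbitrary: V E rule: less_induct)
  case less
  note sg = gain_graph_simple[OF less.prems]
  show ?case
  proof (cases "theta V E = 0")
    case True then show ?thesis using forest_gain_rank[OF less.prems] by simp
  next
    case False
    then have "theta V E > 0" using theta_nonneg[OF sg] by linarith
    then obtain C where C: "C \<in> cycles E" by (rule theta_pos_cycle[OF sg])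
    then obtain vs where vs: "cyc_verts C = set vs" "vs \<noteq> []" "C \<subseteq> E" by (rule cyclesE)
    then obtain x where x: "x \<in> cyc_verts C" using hd_in_set by metis
    then have "x \<in> V" using vs simple_graph_edges_Pow[OF sg] unfolding cyc_verts_def by blast
    from less.hyps[OF card_del_less[OF sg this, of "{x}"] gain_graph_del[OF less.prems]]
    have "int (graph_rank (V - {x}) (del_edges E {x})) - 2 * theta (V - {x}) (del_edges E {x})
      \<le> int (gain_rank (V - {x}) (del_edges E {x}) \<phi>)" by simp
    then show ?thesis
      using theta_delete_cycle_vertex[OF sg C x] gain_rank_del_le[OF less.prems, of x] graph_rank_le_del[OF sg, of x]
      by linarith
  qed
qed

section \<open>Extremal graphs and the deletions that preserve them\<close>

definition extremal :: "'a set \<Rightarrow> 'a set set \<Rightarrow> ('a \<Rightarrow> 'a \<Rightarrow> complex) \<Rightarrow> bool" where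
  "extremal V E \<phi> \<longleftrightarrow> gain_graph V E \<phi> \<and>
     int (gain_rank V E \<phi>) = int (graph_rank V E) - 2 * theta V E"

lemma extremal_gain_graph: "extremal V E \<phi> \<Longrightarrow> gain_graph V E \<phi>"
  unfolding extremal_def by blast

lemma extremal_simple: "extremal V E \<phi> \<Longrightarrow> simple_graph V E"
  using extremal_gain_graph gain_graph_simple by blast

lemma cyc_verts_subset: "simple_graph V E \<Longrightarrow> C \<in> cycles E \<Longrightarrow> cyc_verts C \<subseteq> V"
  using cycles_subset simple_graph_edges_Pow unfolding cyc_verts_def by blast

text \<open>The chain r(G) - 2 \<theta>(G) \<le> r(G - x) - 2 \<theta>(G - x) \<le> r(\<Phi> - x)
  \<le> r(\<Phi>) closes up for an extremal graph, which pins every quantity in it.\<close>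

lemma extremal_delete_cycle_vertex:
  assumes "extremal V E \<phi>" "C \<in> cycles E" "x \<in> cyc_verts C"
  shows "extremal (V - {x}) (del_edges E {x}) \<phi>"
    and "gain_rank (V - {x}) (del_edges E {x}) \<phi> = gain_rank V E \<phi>"
    and "graph_rank V E = graph_rank (V - {x}) (del_edges E {x}) + 2"
    and "theta (V - {x}) (del_edges E {x}) = theta V E - 1"
  using theta_delete_cycle_vertex[OF extremal_simple[OF assms(1)] assms(2,3)]
    gain_rank_del_le[OF extremal_gain_graph[OF assms(1)], of x]
    graph_rank_le_del[OF extremal_simple[OF assms(1)], of x]
    gain_rank_lower_bound[OF gain_graph_del[OF extremal_gain_graph[OF assms(1)]], of "{x}"]
    assms(1) gain_graph_del[OF extremal_gain_graph[OF assms(1)], of "{x}"]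
  unfolding extremal_def by auto

text \<open>Here \<open>k\<close> is the drop of the gain rank and bounds the drop of the graph
  rank; the lower bound for the rest then leaves no room for \<open>theta\<close> to fall. It serves
  with \<open>k = 0\<close> for isolated vertices and with \<open>k = 2\<close> for pendant pairs
  and for the outer neighbour of a pendant cycle.\<close>

lemma extremal_delete_set:
  assumes "extremal V E \<phi>" "S \<subseteq> V" "gain_rank V E \<phi> = gain_rank (V - S) (del_edges E S) \<phi> + k"
    and "graph_rank V E \<le> graph_rank (V - S) (del_edges E S) + k"
  shows "extremal (V - S) (del_edges E S) \<phi>"
    and "graph_rank V E = graph_rank (V - S) (del_edges E S) + k"
    and "theta (V - S) (del_edges E S) = theta V E"
  using theta_del_le[OF extremal_simple[OF assms(1)] assms(2)] assms
    gain_rank_lower_bound[OF gain_graph_del[OF extremal_gain_graph[OF assms(1)]], of S]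
    gain_graph_del[OF extremal_gain_graph[OF assms(1)], of S]
  unfolding extremal_def by auto

lemma extremal_isolated:
  assumes "extremal V E \<phi>" "v \<in> V" "\<And>e. e \<in> E \<Longrightarrow> v \<notin> e"
  shows "extremal (V - {v}) (del_edges E {v}) \<phi>"
proof (rule extremal_delete_set(1)[OF assms(1), of _ 0])
  show "gain_rank V E \<phi> = gain_rank (V - {v}) (del_edges E {v}) \<phi> + 0"
    using gain_rank_isolated[OF extremal_gain_graph[OF assms(1)] assms(2,3)] by simp
  show "graph_rank V E \<le> graph_rank (V - {v}) (del_edges E {v}) + 0"
    using graph_rank_isolated[OF extremal_simple[OF assms(1)] assms(2,3)] by simp
qed (use assms in auto)

text \<open>Removing a pendant pair lowers both ranks by 2, so \<open>theta\<close> is preserved;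
  were \<open>u\<close> on a cycle, deleting \<open>u\<close> would already lower
  \<open>theta\<close>.\<close>

lemma extremal_pendant:
  assumes "extremal V E \<phi>" "{u, v} \<in> E" "\<And>e. e \<in> E \<Longrightarrow> v \<in> e \<Longrightarrow> e = {u, v}"
  shows "extremal (V - {u, v}) (del_edges E {u, v}) \<phi>"
    and "C \<in> cycles E \<Longrightarrow> u \<notin> cyc_verts C"
proof -
  note sg = extremal_simple[OF assms(1)]
  have uv: "{u, v} \<subseteq> V" using simple_graphD[OF sg assms(2)] by simp
  have gr: "gain_rank V E \<phi> = gain_rank (V - {u, v}) (del_edges E {u, v}) \<phi> + 2"
    by (rule gain_rank_pendant[OF extremal_gain_graph[OF assms(1)] assms(2,3)])
  have r: "graph_rank V E \<le> graph_rank (V - {u, v}) (del_edges E {u, v}) + 2"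
    using graph_rank_pendant[OF sg assms(2,3)] by simp
  show "extremal (V - {u, v}) (del_edges E {u, v}) \<phi>"
    by (rule extremal_delete_set(1)[OF assms(1) uv gr r])
  have th: "theta (V - {u, v}) (del_edges E {u, v}) = theta V E"
    by (rule extremal_delete_set(3)[OF assms(1) uv gr r])
  assume C: "C \<in> cycles E"
  show "u \<notin> cyc_verts C"
  proof
    assume "u \<in> cyc_verts C"
    then have "theta (V - {u}) (del_edges E {u}) \<le> theta V E - 1"
      by (rule theta_delete_cycle_vertex[OF sg C])
    moreover have "theta (V - {u} - {v}) (del_edges (del_edges E {u}) {v}) \<le> theta (V - {u}) (del_edges E {u})"
      by (rule theta_del_le[OF simple_graph_del[OF sg]]) (use uv simple_graphD[OF sg assms(2)] in auto)
    moreover have "V - {u} - {v} = V - {u, v}" by blast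
    ultimately show False using th by (simp add: del_edges_Un insert_commute)
  qed
qed

lemma extremal_cycles_disjoint:
  assumes "extremal V E \<phi>" "C1 \<in> cycles E" "C2 \<in> cycles E" "C1 \<noteq> C2"
  shows "cyc_verts C1 \<inter> cyc_verts C2 = {}"
proof -
  \<comment> \<open>Of two distinct cycles at least one is not contained in the other, so this
    asymmetric form suffices.\<close>
  have "cyc_verts C \<inter> cyc_verts C' = {}" if C: "C \<in> cycles E" "C' \<in> cycles E" "\<not> C \<subseteq> C'" for C C'
  proof (rule ccontr)
    assume "cyc_verts C \<inter> cyc_verts C' \<noteq> {}"
    with C obtain x where "x \<in> cyc_verts C" "theta (V - {x}) (del_edges E {x}) \<le> theta V E - 2"
      by (rule theta_delete_shared_vertex[OF extremal_simple[OF assms(1)]])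
    then show False using extremal_delete_cycle_vertex(4)[OF assms(1) C(1)] by fastforce
  qed
  then show ?thesis using assms by blast
qed

section \<open>Kernel equations along a cycle\<close>

lemma row_sum_two_neighbours:
  assumes "finite V" "a \<in> V" "b \<in> V" "a \<noteq> b" "{u, a} \<in> E" "{u, b} \<in> E"
    and "\<And>w. {u, w} \<in> E \<Longrightarrow> w = a \<or> w = b"
  shows "(\<Sum>v\<in>V. c v * gain_adj_mat E \<phi> u v) = c a * \<phi> u a + c b * \<phi> u b"
proof -
  have "(\<Sum>v\<in>V. c v * gain_adj_mat E \<phi> u v) = (\<Sum>v\<in>{a, b}. c v * \<phi> u v)"
    by (rule sum.mono_neutral_cong_right) (use assms in \<open>auto simp: gain_adj_mat_def\<close>)
  then show ?thesis using assms by simp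
qed

text \<open>The centre is written as \<open>Suc i\<close> so that its predecessor needs no
  subtraction.\<close>

lemma cyc_nth_neighbours:
  assumes "distinct vs" "length vs \<ge> 3"
  shows "{cyc_nth vs (Suc i), w} \<in> cycle_edges vs \<longleftrightarrow> w = cyc_nth vs i \<or> w = cyc_nth vs (Suc (Suc i))"
proof
  have ne: "vs \<noteq> []" using assms by auto
  assume "{cyc_nth vs (Suc i), w} \<in> cycle_edges vs"
  then obtain j where j: "{cyc_nth vs (Suc i), w} = {cyc_nth vs j, cyc_nth vs (Suc j)}"
    unfolding cycle_edges_cyc_nth[OF ne] by blast
  then consider "cyc_nth vs (Suc i) = cyc_nth vs j" "w = cyc_nth vs (Suc j)"
    | "cyc_nth vs (Suc i) = cyc_nth vs (Suc j)" "w = cyc_nth vs j"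
    unfolding doubleton_eq_iff by metis
  then show "w = cyc_nth vs i \<or> w = cyc_nth vs (Suc (Suc i))"
  proof cases
    case 1
    then have "Suc i mod length vs = j mod length vs" by (simp only: cyc_nth_eq_iff[OF assms(1) ne])
    then have "Suc j mod length vs = Suc (Suc i) mod length vs" by (metis mod_Suc_eq)
    then have "cyc_nth vs (Suc j) = cyc_nth vs (Suc (Suc i))" by (rule cyc_nth_eq_iff[OF assms(1) ne, THEN iffD2])
    then show ?thesis using 1(2) by simp
  next
    case 2
    then have "i mod length vs = j mod length vs"
      using cyc_nth_eq_iff[OF assms(1) ne, of "Suc i" "Suc j"] assms(2) by (auto simp: mod_Suc split: if_splits)
    then have "cyc_nth vs i = cyc_nth vs j" by (rule cyc_nth_eq_iff[OF assms(1) ne, THEN iffD2])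
    then show ?thesis using 2(2) by simp
  qed
next
  have ne: "vs \<noteq> []" using assms by auto
  assume "w = cyc_nth vs i \<or> w = cyc_nth vs (Suc (Suc i))"
  then show "{cyc_nth vs (Suc i), w} \<in> cycle_edges vs"
    unfolding cycle_edges_cyc_nth[OF ne] by (auto simp: insert_commute)
qed

lemma cyc_nth_Suc_Suc_neq:
  assumes "distinct vs" "length vs \<ge> 3"
  shows "cyc_nth vs i \<noteq> cyc_nth vs (Suc (Suc i))"
proof -
  have ne: "vs \<noteq> []" using assms by auto
  show ?thesis unfolding cyc_nth_eq_iff[OF assms(1) ne] using assms(2) by (auto simp: mod_Suc)
qed

text \<open>The premise on edges concerns only the row in question, so the formula also applies to a
  cycle that has outgoing edges at other vertices.\<close>

lemma cycle_row_sum: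
  assumes "gain_graph V E \<phi>" "cycle_list E vs"
    and "\<And>w. {cyc_nth vs (Suc i), w} \<in> E \<Longrightarrow> {cyc_nth vs (Suc i), w} \<in> cycle_edges vs"
  shows "(\<Sum>v\<in>V. c v * gain_adj_mat E \<phi> (cyc_nth vs (Suc i)) v) =
    c (cyc_nth vs i) * \<phi> (cyc_nth vs (Suc i)) (cyc_nth vs i)
    + c (cyc_nth vs (Suc (Suc i))) * \<phi> (cyc_nth vs (Suc i)) (cyc_nth vs (Suc (Suc i)))"
proof -
  note sg = gain_graph_simple[OF assms(1)]
  have vs: "distinct vs" "length vs \<ge> 3" "cycle_edges vs \<subseteq> E" using assms(2) unfolding cycle_list_iff by auto
  have e: "{cyc_nth vs (Suc i), cyc_nth vs i} \<in> E" "{cyc_nth vs (Suc i), cyc_nth vs (Suc (Suc i))} \<in> E"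
    using cyc_nth_neighbours[OF vs(1,2)] vs(3) by blast+
  show ?thesis
  proof (rule row_sum_two_neighbours[OF simple_graph_finite[OF sg] _ _ cyc_nth_Suc_Suc_neq[OF vs(1,2)] e])
    show "cyc_nth vs i \<in> V" "cyc_nth vs (Suc (Suc i)) \<in> V" using simple_graphD[OF sg] e by blast+
    fix w assume "{cyc_nth vs (Suc i), w} \<in> E"
    then show "w = cyc_nth vs i \<or> w = cyc_nth vs (Suc (Suc i))"
      using assms(3) cyc_nth_neighbours[OF vs(1,2)] by blast
  qed
qed

lemma gain_graph_unit:
  assumes "gain_graph V E \<phi>" "{u, v} \<in> E"
  shows "\<phi> u v * \<phi> v u = 1" "\<phi> u v \<noteq> 0"
proof -
  show "\<phi> u v \<noteq> 0" using gain_graph_edge(1)[OF assms] by auto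
  show "\<phi> u v * \<phi> v u = 1"
    using gain_graph_edge[OF assms] complex_norm_square[of "\<phi> u v"] by simp
qed

abbreviation cyc_gain_nth :: "('a \<Rightarrow> 'a \<Rightarrow> complex) \<Rightarrow> 'a list \<Rightarrow> nat \<Rightarrow> complex" where
  "cyc_gain_nth \<phi> vs i \<equiv> \<phi> (cyc_nth vs i) (cyc_nth vs (Suc i))"

text \<open>Row \<open>i + 1\<close> has only two terms. Multiplying by the gain from
  \<open>i\<close> to \<open>i + 1\<close>, the inverse of the gain back, solves it for the value at
  \<open>i\<close>.\<close>

lemma cycle_kernel_step:
  assumes "gain_graph V E \<phi>" "cycle_list E vs"
    and "\<And>w. {cyc_nth vs (Suc i), w} \<in> E \<Longrightarrow> {cyc_nth vs (Suc i), w} \<in> cycle_edges vs"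
    and "in_kernel V (gain_adj_mat E \<phi>) c"
  shows "c (cyc_nth vs i) = - (cyc_gain_nth \<phi> vs i * cyc_gain_nth \<phi> vs (Suc i)) * c (cyc_nth vs (Suc (Suc i)))"
proof -
  have vs: "distinct vs" "length vs \<ge> 3" "vs \<noteq> []" "cycle_edges vs \<subseteq> E"
    using assms(2) unfolding cycle_list_iff by auto
  have e: "{cyc_nth vs i, cyc_nth vs (Suc i)} \<in> E" using vs cycle_edges_cyc_nth by blast
  then have "cyc_nth vs (Suc i) \<in> V" using simple_graphD[OF gain_graph_simple[OF assms(1)]] by blast
  then have "c (cyc_nth vs i) * \<phi> (cyc_nth vs (Suc i)) (cyc_nth vs i)
    + c (cyc_nth vs (Suc (Suc i))) * cyc_gain_nth \<phi> vs (Suc i) = 0"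
    using cycle_row_sum[OF assms(1-3), of c] assms(4) unfolding in_kernel_def by metis
  then have "cyc_gain_nth \<phi> vs i * (c (cyc_nth vs i) * \<phi> (cyc_nth vs (Suc i)) (cyc_nth vs i)
    + c (cyc_nth vs (Suc (Suc i))) * cyc_gain_nth \<phi> vs (Suc i)) = 0" by simp
  moreover have "cyc_gain_nth \<phi> vs i * \<phi> (cyc_nth vs (Suc i)) (cyc_nth vs i) = 1"
    by (rule gain_graph_unit(1)[OF assms(1) e])
  ultimately show ?thesis by algebra
qed

text \<open>The recurrence is demanded only at the \<open>m\<close> places actually used: on a
  pendant cycle the row of the attachment vertex must be avoided.\<close>

lemma two_step_recurrence:
  fixes x g :: "nat \<Rightarrow> complex"
  assumes "\<And>k. k < m \<Longrightarrow> x (j + 2 * k) = - (g (j + 2 * k) * g (Suc (j + 2 * k))) * x (Suc (Suc (j + 2 * k)))"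
  shows "x j = (-1) ^ m * (\<Prod>l<2 * m. g (j + l)) * x (j + 2 * m)"
  using assms
proof (induction m)
  case 0 then show ?case by simp
next
  case (Suc m)
  have "x j = (-1) ^ m * (\<Prod>l<2 * m. g (j + l)) * x (j + 2 * m)" using Suc by simp
  also have "x (j + 2 * m) = - (g (j + 2 * m) * g (Suc (j + 2 * m))) * x (Suc (Suc (j + 2 * m)))"
    using Suc.prems[of m] by simp
  finally show ?case by (simp add: mult_ac)
qed

lemma cycle_gain_eq: "cycle_gain \<phi> vs = (\<Prod>l<length vs. cyc_gain_nth \<phi> vs l)"
  unfolding cycle_gain_def by (rule prod.cong) (auto simp: cyc_nth_def)

section \<open>Cycles of extremal graphs\<close>

text \<open>The two cycle edges at \<open>v\<close> already exhaust its degree.\<close>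

lemma cycle_vertices_degree_2:
  assumes "cycle_list E vs" "v \<in> set vs" "card {e \<in> E. v \<in> e} \<le> 2" "finite E"
  shows "{e \<in> E. v \<in> e} \<subseteq> cycle_edges vs"
proof -
  have vs: "distinct vs" "length vs \<ge> 3" "vs \<noteq> []" "cycle_edges vs \<subseteq> E"
    using assms(1) unfolding cycle_list_iff by auto
  obtain j where j: "v = cyc_nth vs j" using in_set_cyc_nth[OF assms(2)] by blast
  \<comment> \<open>Adding \<open>length vs - 1\<close> is a step back modulo the length, so
    \<open>v\<close> sits at index \<open>Suc i\<close>.\<close>
  define i where "i = j + length vs - 1"
  have i: "v = cyc_nth vs (Suc i)"
  proof -
    have "Suc i = j + length vs" using vs(2) unfolding i_def by linarith
    then show ?thesis using j unfolding cyc_nth_def by simp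
  qed
  let ?F = "{{cyc_nth vs i, v}, {v, cyc_nth vs (Suc (Suc i))}}"
  have F: "?F \<subseteq> cycle_edges vs" unfolding i cycle_edges_cyc_nth[OF vs(3)] by blast
  have "{cyc_nth vs i, v} \<noteq> {v, cyc_nth vs (Suc (Suc i))}"
    using cyc_nth_Suc_Suc_neq[OF vs(1,2), of i] by (auto simp: doubleton_eq_iff)
  then have "card ?F = 2" by simp
  moreover have "?F \<subseteq> {e \<in> E. v \<in> e}" using F vs(4) by auto
  ultimately have "?F = {e \<in> E. v \<in> e}" using assms(3,4) by (intro card_seteq) auto
  then show ?thesis using F by blast
qed

lemma cycle_list_del:
  assumes "cycle_list E vs" "set vs \<inter> S = {}"
  shows "cycle_list (del_edges E S) vs"
proof -
  have vs: "distinct vs" "length vs \<ge> 3" "vs \<noteq> []" "cycle_edges vs \<subseteq> E"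
    using assms(1) unfolding cycle_list_iff by auto
  have "\<Union>(cycle_edges vs) = set vs" using cyc_verts_cycle_edges[OF vs(3)] unfolding cyc_verts_def .
  then have "cycle_edges vs \<subseteq> del_edges E S" using vs(4) assms(2) unfolding del_edges_def by blast
  then show ?thesis using vs unfolding cycle_list_iff by blast
qed

lemma gain_rank_le_card: "finite V \<Longrightarrow> gain_rank V E \<phi> \<le> card V"
  unfolding gain_rank_def by (metis mat_rank_attained card_mono)

lemma graph_rank_le_card: "finite V \<Longrightarrow> graph_rank V E \<le> card V"
  unfolding graph_rank_eq_gain_rank by (rule gain_rank_le_card)

lemma extremal_kernel_vector:
  assumes "extremal V E \<phi>" "C \<in> cycles E" "x \<in> cyc_verts C"
  obtains c where "in_kernel V (gain_adj_mat E \<phi>) c" "c x \<noteq> 0"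
proof (rule kernel_vector_if_rank_delete_eq)
  show "finite V" using assms extremal_simple simple_graph_finite by blast
  show "x \<in> V" using cyc_verts_subset[OF extremal_simple[OF assms(1)] assms(2)] assms(3) by blast
  show "mat_rank (V - {x}) (gain_adj_mat E \<phi>) = mat_rank V (gain_adj_mat E \<phi>)"
    using extremal_delete_cycle_vertex(2)[OF assms] unfolding gain_rank_del unfolding gain_rank_def .
qed (rule that)

lemma extremal_graph_kernel_vanishes:
  assumes "extremal V E \<phi>" "C \<in> cycles E" "x \<in> cyc_verts C"
    and "in_kernel V (gain_adj_mat E (\<lambda>_ _. 1)) c"
  shows "c x = 0"
proof (rule ccontr)
  assume "c x \<noteq> 0"
  note sg = extremal_simple[OF assms(1)]
  have "mat_rank (V - {x}) (gain_adj_mat E (\<lambda>_ _. 1)) = mat_rank V (gain_adj_mat E (\<lambda>_ _. 1))"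
    by (rule rank_delete_eq_if_kernel_vector[OF simple_graph_finite[OF sg]
          gain_graph_hermitian[OF gain_graph_one[OF sg]] _ assms(4) \<open>c x \<noteq> 0\<close>])
      (use cyc_verts_subset[OF sg assms(2)] assms(3) in blast)
  then show False
    using extremal_delete_cycle_vertex(3)[OF assms(1-3)]
    unfolding graph_rank_eq_gain_rank gain_rank_del unfolding gain_rank_def by simp
qed

text \<open>Row i + 1 of a lone cycle reads c i + c (i + 2) = 0; if 4 divides the length, the vector
  1, 0, -1, 0, ... solves all of these equations.\<close>

lemma lone_cycle_kernel_4_dvd:
  assumes "simple_graph V E" "cycle_list E vs" "4 dvd length vs"
    and "\<And>v e. v \<in> set vs \<Longrightarrow> e \<in> E \<Longrightarrow> v \<in> e \<Longrightarrow> e \<in> cycle_edges vs"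
  obtains c where "in_kernel V (gain_adj_mat E (\<lambda>_ _. 1)) c" "c (cyc_nth vs 0) \<noteq> 0"
proof -
  have vs: "distinct vs" "length vs \<ge> 3" "vs \<noteq> []" "cycle_edges vs \<subseteq> E"
    using assms(2) unfolding cycle_list_iff by auto
  define f :: "nat \<Rightarrow> complex" where "f i = (if i mod 4 = 0 then 1 else if i mod 4 = 2 then -1 else 0)" for i
  \<comment> \<open>\<open>SOME\<close> picks an arbitrary index; the value does not depend on it
    because \<open>f\<close> has period 4 and 4 divides the length.\<close>
  define c where "c v = (if v \<in> set vs then f (SOME i. v = cyc_nth vs i) else 0)" for v
  have c: "c (cyc_nth vs i) = f i" for i
  proof -
    let ?j = "SOME j. cyc_nth vs i = cyc_nth vs j"
    have "cyc_nth vs i = cyc_nth vs ?j" by (rule someI) simp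
    then have "i mod length vs = ?j mod length vs" by (simp only: cyc_nth_eq_iff[OF vs(1,3)])
    then have "i mod 4 = ?j mod 4" using assms(3) by (metis mod_mod_cancel)
    then show ?thesis using cyc_nth_in_set[OF vs(3)] unfolding c_def f_def by simp
  qed
  have f: "f i + f (Suc (Suc i)) = 0" for i
    unfolding f_def by (auto simp: mod_Suc)
  have "in_kernel V (gain_adj_mat E (\<lambda>_ _. 1)) c"
    unfolding in_kernel_def
  proof
    fix u assume u: "u \<in> V"
    show "(\<Sum>v\<in>V. c v * gain_adj_mat E (\<lambda>_ _. 1) u v) = 0"
    proof (cases "u \<in> set vs")
      case True
      then obtain j where j: "u = cyc_nth vs j" using in_set_cyc_nth by metis
      define i where "i = j + length vs - 1"
      have "Suc i = j + length vs" using vs(2) unfolding i_def by linarith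
      then have i: "u = cyc_nth vs (Suc i)" using j unfolding cyc_nth_def by simp
      have "(\<Sum>v\<in>V. c v * gain_adj_mat E (\<lambda>_ _. 1) (cyc_nth vs (Suc i)) v) = f i * 1 + f (Suc (Suc i)) * 1"
        unfolding c[symmetric]
        by (rule cycle_row_sum[OF gain_graph_one[OF assms(1)] assms(2)])
          (use assms(4)[OF cyc_nth_in_set[OF vs(3)]] in auto)
      then show ?thesis using f i by simp
    next
      case False
      have "c v * gain_adj_mat E (\<lambda>_ _. 1) u v = 0" for v
      proof (cases "v \<in> set vs \<and> {u, v} \<in> E")
        case True
        then have "{u, v} \<in> cycle_edges vs" using assms(4) by blast
        then have "u \<in> cyc_verts (cycle_edges vs)" unfolding cyc_verts_def by blast
        then show ?thesis using False cyc_verts_cycle_edges[OF vs(3)] by simp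
      next
        case F: False then show ?thesis by (auto simp: c_def gain_adj_mat_def)
      qed
      then show ?thesis by (intro sum.neutral) blast
    qed
  qed
  then show ?thesis using that c[of 0] by (simp add: f_def)
qed

lemma extremal_lone_cycle_type:
  assumes "extremal V E \<phi>" "cycle_list E vs" "V = set vs"
    and deg: "\<And>v e. v \<in> set vs \<Longrightarrow> e \<in> E \<Longrightarrow> v \<in> e \<Longrightarrow> e \<in> cycle_edges vs"
  shows "type_A \<phi> vs \<and> length vs mod 4 = 2"
proof -
  note gg = extremal_gain_graph[OF assms(1)] and sg = extremal_simple[OF assms(1)]
  have vs: "distinct vs" "length vs \<ge> 3" "vs \<noteq> []" "cycle_edges vs \<subseteq> E"
    using assms(2) unfolding cycle_list_iff by auto
  have fin: "finite V" using simple_graph_finite[OF sg] .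
  have C: "cycle_edges vs \<in> cycles E" using assms(2) unfolding cycles_def by blast
  have x: "cyc_nth vs i \<in> cyc_verts (cycle_edges vs)" for i
    using cyc_verts_cycle_edges[OF vs(3)] cyc_nth_in_set[OF vs(3)] by simp
  have cV: "card V = length vs" using assms(3) vs(1) by (simp add: distinct_card)
  let ?g = "cyc_gain_nth \<phi> vs"
  have nbr: "{cyc_nth vs (Suc i), w} \<in> cycle_edges vs" if "{cyc_nth vs (Suc i), w} \<in> E" for i w
    by (rule deg[OF cyc_nth_in_set[OF vs(3), of "Suc i"] that]) simp
  have rec: "c (cyc_nth vs 0) = (-1) ^ m * (\<Prod>l<2 * m. ?g l) * c (cyc_nth vs (2 * m))"
    if "in_kernel V (gain_adj_mat E \<phi>) c" for c m
    using two_step_recurrence[of m "\<lambda>i. c (cyc_nth vs i)" 0 ?g, OF cycle_kernel_step[OF gg assms(2) nbr that]]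
    by (simp only: add_0)
  \<comment> \<open>If the length is odd, \<open>theta\<close> at least 1 makes the nullity at least
    2, so a nonzero kernel vector vanishes at index 0. Steps of two reach every vertex, so it would
    vanish everywhere.\<close>
  have even: "even (length vs)"
  proof (rule ccontr)
    assume odd: "odd (length vs)"
    have "int (gain_rank V E \<phi>) \<le> int (length vs) - 2"
    proof -
      have "theta V E \<ge> 1"
        using theta_delete_cycle_vertex[OF sg C x[of 0]]
          theta_nonneg[OF simple_graph_del[OF sg], of "{cyc_nth vs 0}"] by linarith
      then show ?thesis using assms(1) graph_rank_le_card[OF fin, of E] cV unfolding extremal_def by linarith
    qed
    then have "mat_rank V (gain_adj_mat E \<phi>) + card {cyc_nth vs 0} < card V"
      using cV unfolding gain_rank_def by simp
    then obtain c v where c: "in_kernel V (gain_adj_mat E \<phi>) c" "\<And>s. s \<in> {cyc_nth vs 0} \<Longrightarrow> c s = 0" "v \<in> V" "c v \<noteq> 0"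
      using kernel_vector_vanishing_on[OF fin, of "{cyc_nth vs 0}" "gain_adj_mat E \<phi>"]
        cyc_nth_in_set[OF vs(3)] assms(3) by (metis empty_subsetI insert_subset)
    obtain i where i: "v = cyc_nth vs i" using c(3) assms(3) in_set_cyc_nth by metis
    \<comment> \<open>For odd length, \<open>(length vs + 1) div 2\<close> double steps advance by
      one vertex; doing this \<open>i\<close> times leads to \<open>v\<close>.\<close>
    let ?m = "i * ((length vs + 1) div 2)"
    have "2 * ((length vs + 1) div 2) = length vs + 1" using odd by presburger
    then have "2 * ?m = i * (length vs + 1)" by (metis mult.left_commute)
    then have "cyc_nth vs (2 * ?m) = v" unfolding i cyc_nth_def by simp
    then have "(-1) ^ ?m * (\<Prod>l<2 * ?m. ?g l) * c v = 0" using rec[OF c(1), of ?m] c(2) by simp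
    moreover have "?g l \<noteq> 0" for l
    proof (rule gain_graph_unit(2)[OF gg])
      show "{cyc_nth vs l, cyc_nth vs (Suc l)} \<in> E" using vs(4) cycle_edges_cyc_nth[OF vs(3)] by blast
    qed
    ultimately show False using c(4) by simp
  qed
  have "cycle_gain \<phi> vs = (-1) ^ (length vs div 2)"
  proof -
    obtain c where c: "in_kernel V (gain_adj_mat E \<phi>) c" "c (cyc_nth vs 0) \<noteq> 0"
      by (rule extremal_kernel_vector[OF assms(1) C x])
    \<comment> \<open>This many double steps make one full turn and collect the gain of the whole
      cycle.\<close>
    let ?m = "length vs div 2"
    have m: "2 * ?m = length vs" using even by simp
    have "cyc_nth vs (length vs) = cyc_nth vs 0" by (simp add: cyc_nth_def)
    then have "c (cyc_nth vs 0) = (-1) ^ ?m * cycle_gain \<phi> vs * c (cyc_nth vs 0)"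
      using rec[OF c(1), of ?m] unfolding m cycle_gain_eq by simp
    then have "(-1) ^ ?m * cycle_gain \<phi> vs = 1" using c(2) by simp
    then have "(-1) ^ ?m * ((-1) ^ ?m * cycle_gain \<phi> vs) = (-1) ^ ?m" by simp
    then show ?thesis by (simp add: mult.assoc[symmetric] power_add[symmetric] mult_2[symmetric])
  qed
  moreover have "\<not> 4 dvd length vs"
  proof
    assume "4 dvd length vs"
    then obtain c where "in_kernel V (gain_adj_mat E (\<lambda>_ _. 1)) c" "c (cyc_nth vs 0) \<noteq> 0"
      by (rule lone_cycle_kernel_4_dvd[OF sg assms(2) _ deg])
    then show False using extremal_graph_kernel_vanishes[OF assms(1) C x] by blast
  qed
  ultimately show ?thesis using even unfolding type_A_def by presburger
qed

text \<open>Degrees at least 2 give at least as many edges as vertices, so \<open>theta\<close>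
  equal to 1 forces equality and a single component. All degrees are then 2, no edge leaves the
  cycle, and connectedness makes it the whole graph.\<close>

lemma unicyclic_min_degree_2:
  assumes sg: "simple_graph V E" and th: "theta V E = 1" and cyc: "cycle_list E vs"
    and deg: "\<And>v. v \<in> V \<Longrightarrow> card {e \<in> E. v \<in> e} \<ge> 2"
  shows "V = set vs" and "\<And>v e. v \<in> set vs \<Longrightarrow> e \<in> E \<Longrightarrow> v \<in> e \<Longrightarrow> e \<in> cycle_edges vs"
proof -
  have vs: "distinct vs" "length vs \<ge> 3" "vs \<noteq> []" "cycle_edges vs \<subseteq> E"
    using cyc unfolding cycle_list_iff by auto
  have fin: "finite V" "finite E" using simple_graph_finite[OF sg] simple_graph_finite_edges[OF sg] .
  have sub: "set vs \<subseteq> V"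
    using cyc_verts_cycle_edges[OF vs(3)] cyc_verts_subset[OF sg] cyc unfolding cycles_def by blast
  then have ne: "V \<noteq> {}" using vs(3) by auto
  have pos: "num_components V E > 0" by (rule num_components_pos[OF fin(1) ne])
  have "(\<Sum>v\<in>V. 2) \<le> (\<Sum>v\<in>V. card {e \<in> E. v \<in> e})" by (intro sum_mono deg)
  then have ge: "card V \<le> card E" using handshake[OF sg] by simp
  then have eq: "card E = card V" and one: "num_components V E = 1" using th pos unfolding theta_def by linarith+
  have deg2: "card {e \<in> E. v \<in> e} \<le> 2" if v: "v \<in> V" for v
  proof (rule ccontr)
    assume "\<not> ?thesis"
    then have "(\<Sum>v\<in>V. 2) < (\<Sum>v\<in>V. card {e \<in> E. v \<in> e})"
      by (intro sum_strict_mono_ex1[OF fin(1)] bexI[OF _ v]) (use deg in auto)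
    then show False using handshake[OF sg] eq by simp
  qed
  show closed: "e \<in> cycle_edges vs" if "v \<in> set vs" "e \<in> E" "v \<in> e" for v e
    using cycle_vertices_degree_2[OF cyc that(1) deg2 fin(2)] that sub by blast
  obtain X where X: "component V E ` V = {X}"
    using one unfolding num_components_eq by (rule card_1_singletonE)
  have "v \<in> set vs" if v: "v \<in> V" for v
  proof -
    have x: "hd vs \<in> V" "hd vs \<in> set vs" using vs(3) sub by auto
    then have "component V E (hd vs) = component V E v" using X v by blast
    then have "reach E (hd vs) v" using component_eq_iff x v by metis
    then show ?thesis
    proof (rule reach_closed[OF _ x(2)])
      fix a b assume "a \<in> set vs" "{a, b} \<in> E"
      then have "{a, b} \<in> cycle_edges vs" using closed by blast
      then show "b \<in> set vs" using cyc_verts_cycle_edges[OF vs(3)] unfolding cyc_verts_def by blast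
    qed
  qed
  then show "V = set vs" using sub by blast
qed

text \<open>The given cycle is laid bare by deleting vertices of other cycles, isolated vertices and
  pendant pairs. None of these meets it: cycles are disjoint, and the neighbour of a pendant vertex
  lies on no cycle.\<close>

lemma extremal_cycle_type:
  assumes "extremal V E \<phi>" "cycle_list E vs"
  shows "type_A \<phi> vs \<and> length vs mod 4 = 2"
  using assms
proof (induction "card V" arbitrary: V E rule: less_induct)
  case less
  note sg = extremal_simple[OF less.prems(1)]
  have vs: "distinct vs" "length vs \<ge> 3" "vs \<noteq> []" "cycle_edges vs \<subseteq> E"
    using less.prems(2) unfolding cycle_list_iff by auto
  have C: "cycle_edges vs \<in> cycles E" using less.prems(2) unfolding cycles_def by blast
  have verts: "cyc_verts (cycle_edges vs) = set vs" by (rule cyc_verts_cycle_edges[OF vs(3)])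
  have IH: ?case if "extremal (V - S) (del_edges E S) \<phi>" "v \<in> V" "v \<in> S" "set vs \<inter> S = {}" for S v
    by (rule less.hyps[OF card_del_less[OF sg that(2,3)] that(1) cycle_list_del[OF less.prems(2) that(4)]])
  consider (other) C' where "C' \<in> cycles E" "C' \<noteq> cycle_edges vs"
    | (leaf) v where "v \<in> V" "card {e \<in> E. v \<in> e} \<le> 1"
    | (lone) "\<And>C'. C' \<in> cycles E \<Longrightarrow> C' = cycle_edges vs" "\<And>v. v \<in> V \<Longrightarrow> card {e \<in> E. v \<in> e} \<ge> 2"
    by (metis One_nat_def not_less_eq_eq numeral_2_eq_2)
  then show ?case
  proof cases
    case other
    obtain us where us: "cyc_verts C' = set us" "us \<noteq> []" by (rule cyclesE[OF other(1)])
    then have x: "hd us \<in> cyc_verts C'" by simp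
    show ?thesis
    proof (rule IH)
      show "extremal (V - {hd us}) (del_edges E {hd us}) \<phi>"
        by (rule extremal_delete_cycle_vertex(1)[OF less.prems(1) other(1) x])
      show "hd us \<in> V" using x cyc_verts_subset[OF sg other(1)] by blast
      show "set vs \<inter> {hd us} = {}"
        using extremal_cycles_disjoint[OF less.prems(1) other(1) C other(2)] x verts by blast
    qed simp
  next
    case leaf
    have onC: "\<exists>e\<in>cycle_edges vs. w \<in> e" if "w \<in> set vs" for w
      using that verts unfolding cyc_verts_def by blast
    from sg leaf(2) show ?thesis
    proof (cases rule: degree_le_1_cases)
      case isolated
      show ?thesis
      proof (rule IH)
        show "extremal (V - {v}) (del_edges E {v}) \<phi>" by (rule extremal_isolated[OF less.prems(1) leaf(1) isolated])
        show "set vs \<inter> {v} = {}" using onC isolated vs(4) by blast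
      qed (use leaf in auto)
    next
      case (pendant u)
      have u: "u \<notin> set vs" using extremal_pendant(2)[OF less.prems(1) pendant C] verts by simp
      have v: "v \<notin> set vs"
      proof
        assume "v \<in> set vs"
        then obtain e where e: "e \<in> cycle_edges vs" "v \<in> e" using onC by blast
        then have "e = {u, v}" using pendant(2) vs(4) by blast
        then show False using e u verts unfolding cyc_verts_def by blast
      qed
      show ?thesis
      proof (rule IH)
        show "extremal (V - {u, v}) (del_edges E {u, v}) \<phi>" by (rule extremal_pendant(1)[OF less.prems(1) pendant])
        show "set vs \<inter> {u, v} = {}" using u v by blast
      qed (use leaf in auto)
    qed
  next
    case lone
    have x: "hd vs \<in> cyc_verts (cycle_edges vs)" using verts vs(3) by simp
    \<comment> \<open>Without \<open>hd vs\<close> no cycle is left, so \<open>theta\<close> has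
      fallen to 0, and it fell by exactly 1.\<close>
    have "theta V E = 1"
    proof -
      have "theta (V - {hd vs}) (del_edges E {hd vs}) = 0"
      proof (rule ccontr)
        assume "\<not> ?thesis"
        then have "theta (V - {hd vs}) (del_edges E {hd vs}) > 0"
          using theta_nonneg[OF simple_graph_del[OF sg], of "{hd vs}"] by linarith
        then obtain C' where C': "C' \<in> cycles (del_edges E {hd vs})"
          by (rule theta_pos_cycle[OF simple_graph_del[OF sg]])
        then have "C' = cycle_edges vs" using cycles_mono[OF del_edges_subset] lone(1) by blast
        then have "hd vs \<in> \<Union>C'" using x unfolding cyc_verts_def by simp
        then show False using cycles_subset[OF C'] unfolding del_edges_def by blast
      qed
      then show ?thesis using extremal_delete_cycle_vertex(4)[OF less.prems(1) C x] by simp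
    qed
    then show ?thesis
      using extremal_lone_cycle_type[OF less.prems] unicyclic_min_degree_2[OF sg _ less.prems(2) lone(2)] by blast
  qed
qed

section \<open>The contracted graph\<close>

text \<open>The fibre of the contraction map over a vertex of T_G.\<close>

fun block :: "'a + 'a set set \<Rightarrow> 'a set" where
  "block (Inl u) = {u}"
| "block (Inr C) = cyc_verts C"

lemma TG_edgeE:
  assumes "e \<in> TG_edges V E"
  obtains s t where "e = {s, t}"
  using assms unfolding TG_edges_def by blast

lemma cyc_verts_nonempty: "C \<in> cycles E \<Longrightarrow> cyc_verts C \<noteq> {}"
  by (erule cyclesE) simp

lemma finite_cycles:
  assumes "simple_graph V E" shows "finite (cycles E)"
proof -
  have "cycles E \<subseteq> Pow E" using cycles_subset by blast
  then show ?thesis using simple_graph_finite_edges[OF assms] finite_subset by blast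
qed

lemma set_of_doubletons_eqI:
  assumes "\<And>e. e \<in> A \<Longrightarrow> \<exists>s t. e = {s, t}" "\<And>e. e \<in> B \<Longrightarrow> \<exists>s t. e = {s, t}"
    and "\<And>s t. {s, t} \<in> A \<longleftrightarrow> {s, t} \<in> B"
  shows "A = B"
  using assms by (metis subsetI subset_antisym)

text \<open>Part (a) is all that the combinatorics of the contraction takes from extremality:
  disjointness makes the blocks a partition of \<open>V\<close>.\<close>

locale disjoint_cycles =
  fixes V :: "'a set" and E :: "'a set set"
  assumes simple: "simple_graph V E"
    and disjoint: "\<And>C1 C2. C1 \<in> cycles E \<Longrightarrow> C2 \<in> cycles E \<Longrightarrow> C1 \<noteq> C2 \<Longrightarrow> cyc_verts C1 \<inter> cyc_verts C2 = {}"
begin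

lemma TG_vertsE:
  assumes "s \<in> TG_verts V E"
  obtains (Inl) u where "s = Inl u" "u \<in> V" "\<And>C. C \<in> cycles E \<Longrightarrow> u \<notin> cyc_verts C"
    | (Inr) C where "s = Inr C" "C \<in> cycles E"
  using assms unfolding TG_verts_def non_cycle_verts_def by blast

lemma Inl_in_TG_verts: "Inl u \<in> TG_verts V E \<longleftrightarrow> u \<in> non_cycle_verts V E"
  unfolding TG_verts_def by auto

lemma Inr_in_TG_verts: "Inr C \<in> TG_verts V E \<longleftrightarrow> C \<in> cycles E"
  unfolding TG_verts_def by auto

text \<open>Blocks merge the three kinds of edges into one description, so later arguments need not
  tell cycles from single vertices.\<close>

lemma TG_edges_iff:
  "{s, t} \<in> TG_edges V E \<longleftrightarrow>
    s \<in> TG_verts V E \<and> t \<in> TG_verts V E \<and> s \<noteq> t \<and> (\<exists>a\<in>block s. \<exists>b\<in>block t. {a, b} \<in> E)"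
proof -
  have comm: "{a, b} \<in> E \<longleftrightarrow> {b, a} \<in> E" for a b by (simp add: insert_commute)
  have irr: "{a, a} \<notin> E" for a using simple_graphD(3)[OF simple, of a a] by blast
  show ?thesis
  proof (cases s; cases t)
    fix u w assume st: "s = Inl u" "t = Inl w"
    have "{s, t} \<in> TG_edges V E \<longleftrightarrow> u \<in> non_cycle_verts V E \<and> w \<in> non_cycle_verts V E \<and> {u, w} \<in> E"
      unfolding TG_edges_def st by (auto simp: doubleton_eq_iff insert_commute)
    then show ?thesis unfolding st using irr by (auto simp: Inl_in_TG_verts)
  next
    fix u C assume st: "s = Inl u" "t = Inr C"
    have "{s, t} \<in> TG_edges V E \<longleftrightarrow> u \<in> non_cycle_verts V E \<and> C \<in> cycles E \<and> (\<exists>w\<in>cyc_verts C. {u, w} \<in> E)"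
      unfolding TG_edges_def st by (auto simp: doubleton_eq_iff)
    then show ?thesis unfolding st by (auto simp: Inl_in_TG_verts Inr_in_TG_verts)
  next
    fix u C assume st: "s = Inr C" "t = Inl u"
    have "{s, t} \<in> TG_edges V E \<longleftrightarrow> u \<in> non_cycle_verts V E \<and> C \<in> cycles E \<and> (\<exists>w\<in>cyc_verts C. {u, w} \<in> E)"
      unfolding TG_edges_def st by (auto simp: doubleton_eq_iff)
    then show ?thesis unfolding st by (auto simp: Inl_in_TG_verts Inr_in_TG_verts insert_commute)
  next
    fix C D assume st: "s = Inr C" "t = Inr D"
    have "{s, t} \<in> TG_edges V E \<longleftrightarrow> C \<in> cycles E \<and> D \<in> cycles E \<and> C \<noteq> D \<and>
        (\<exists>x\<in>cyc_verts C. \<exists>y\<in>cyc_verts D. {x, y} \<in> E)"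
      unfolding TG_edges_def st by (auto simp: doubleton_eq_iff) (metis comm)+
    then show ?thesis unfolding st by (auto simp: Inr_in_TG_verts)
  qed
qed

lemma TG_simple: "simple_graph (TG_verts V E) (TG_edges V E)"
proof -
  have "finite (TG_verts V E)"
    unfolding TG_verts_def non_cycle_verts_def
    using simple_graph_finite[OF simple] finite_cycles[OF simple] by simp
  moreover have "\<exists>s t. e = {s, t} \<and> s \<noteq> t \<and> s \<in> TG_verts V E \<and> t \<in> TG_verts V E" if e: "e \<in> TG_edges V E" for e
  proof -
    obtain s t where "e = {s, t}" using TG_edgeE[OF e] by blast
    then show ?thesis using e TG_edges_iff by metis
  qed
  ultimately show ?thesis unfolding simple_graph_def by blast
qed

lemma block_subset: "s \<in> TG_verts V E \<Longrightarrow> block s \<subseteq> V"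
  by (erule TG_vertsE) (use cyc_verts_subset[OF simple] in auto)

lemma block_nonempty: "s \<in> TG_verts V E \<Longrightarrow> block s \<noteq> {}"
  by (erule TG_vertsE) (use cyc_verts_nonempty in auto)

lemma block_disjoint:
  assumes "s \<in> TG_verts V E" "t \<in> TG_verts V E" "a \<in> block s" "a \<in> block t"
  shows "s = t"
  using assms(1)
proof (cases rule: TG_vertsE)
  case (Inl u)
  from assms(2) show ?thesis by (cases rule: TG_vertsE) (use Inl assms in auto)
next
  case (Inr C)
  from assms(2) show ?thesis by (cases rule: TG_vertsE) (use Inr assms disjoint in auto)
qed

lemma block_cover:
  assumes "a \<in> V" obtains s where "s \<in> TG_verts V E" "a \<in> block s"
proof (cases "a \<in> non_cycle_verts V E")
  case True
  then show ?thesis using that[of "Inl a"] by (simp add: Inl_in_TG_verts)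
next
  case False
  then obtain C where "C \<in> cycles E" "a \<in> cyc_verts C" using assms unfolding non_cycle_verts_def by blast
  then show ?thesis using that[of "Inr C"] by (simp add: Inr_in_TG_verts)
qed

section \<open>Edges between and within blocks\<close>

lemma not_in_cycle_if_between_blocks:
  assumes "s \<in> TG_verts V E" "t \<in> TG_verts V E" "s \<noteq> t" "a \<in> block s" "b \<in> block t" "C \<in> cycles E"
  shows "{a, b} \<notin> C"
proof
  assume "{a, b} \<in> C"
  then have "a \<in> block (Inr C)" "b \<in> block (Inr C)" by (auto simp: cyc_verts_def)
  moreover have "Inr C \<in> TG_verts V E" using assms(6) by (simp add: Inr_in_TG_verts)
  ultimately have "s = Inr C" "t = Inr C" using block_disjoint assms by blast+
  then show False using assms(3) by blast
qed

text \<open>A non-bridge lies on a cycle, but all vertices of a cycle belong to one block.\<close>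

lemma edge_between_blocks_bridge:
  assumes "s \<in> TG_verts V E" "t \<in> TG_verts V E" "s \<noteq> t" "a \<in> block s" "b \<in> block t" "{a, b} \<in> E"
  shows "\<not> reach (E - {{a, b}}) a b"
proof
  assume "reach (E - {{a, b}}) a b"
  with simple_graphD(3)[OF simple assms(6)] obtain C where "C \<in> cycles E" "{a, b} \<in> C"
    by (rule nonbridge_on_cycle[OF assms(6)])
  then show False using not_in_cycle_if_between_blocks assms by blast
qed

lemma reach_within_block:
  assumes "s \<in> TG_verts V E" "t \<in> TG_verts V E" "s \<noteq> t" "a \<in> block s" "b \<in> block t"
    and "r \<in> TG_verts V E" "x \<in> block r" "y \<in> block r"
  shows "reach (E - {{a, b}}) x y"
  using assms(6)
proof (cases rule: TG_vertsE)
  case (Inl u)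
  then show ?thesis using assms by simp
next
  case (Inr C)
  then have "reach C x y" using reach_within_cycle assms(7,8) by simp
  then show ?thesis
    by (rule reach_mono) (use not_in_cycle_if_between_blocks[OF assms(1-5) Inr(2)] cycles_subset[OF Inr(2)] in blast)
qed

text \<open>A second edge between the same blocks, together with connections inside the blocks,
  would bypass the first edge, which is a bridge. So a leaf of T_G with a neighbour is attached by a
  single edge of G.\<close>

lemma edge_between_blocks_unique:
  assumes "s \<in> TG_verts V E" "t \<in> TG_verts V E" "s \<noteq> t" "a \<in> block s" "b \<in> block t" "{a, b} \<in> E"
    and "a' \<in> block s" "b' \<in> block t" "{a', b'} \<in> E"
  shows "a' = a \<and> b' = b"
proof (cases "{a', b'} = {a, b}")
  case True
  then show ?thesis using block_disjoint assms by (metis doubleton_eq_iff)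
next
  case False
  then have "reach (E - {{a, b}}) a' b'" using assms by (intro reach_edge) simp
  moreover have "reach (E - {{a, b}}) a a'" "reach (E - {{a, b}}) b' b"
    using reach_within_block[OF assms(1-5)] assms by blast+
  ultimately have "reach (E - {{a, b}}) a b" using reach_trans by metis
  then show ?thesis using edge_between_blocks_bridge assms by blast
qed

text \<open>A chord would lie on a second cycle through \<open>a\<close>, against
  disjointness.\<close>

lemma chord_in_cycle:
  assumes "C \<in> cycles E" "a \<in> cyc_verts C" "b \<in> cyc_verts C" "{a, b} \<in> E"
  shows "{a, b} \<in> C"
proof (rule ccontr)
  assume notin: "{a, b} \<notin> C"
  have "reach (E - {{a, b}}) a b"
    using reach_within_cycle[OF assms(1-3)] by (rule reach_mono) (use notin cycles_subset[OF assms(1)] in blast)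
  with simple_graphD(3)[OF simple assms(4)] obtain C' where C': "C' \<in> cycles E" "{a, b} \<in> C'"
    by (rule nonbridge_on_cycle[OF assms(4)])
  then have "a \<in> cyc_verts C'" unfolding cyc_verts_def by blast
  then have "C' = C" using disjoint[OF C'(1) assms(1)] assms(2) by blast
  then show False using C' notin by blast
qed

text \<open>A connection in the contracted graph that avoids one of its edges lifts to a connection
  in the graph that avoids the corresponding edge, so a cycle of the contracted graph would turn
  that edge into an edge of a cycle.\<close>

lemma TG_forest: "theta (TG_verts V E) (TG_edges V E) = 0"
proof (rule ccontr)
  assume "\<not> ?thesis"
  then have "theta (TG_verts V E) (TG_edges V E) > 0" using theta_nonneg[OF TG_simple] by linarith
  then obtain s t where st: "{s, t} \<in> TG_edges V E" "reach (TG_edges V E - {{s, t}}) s t"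
    by (rule theta_pos_nonbridge[OF TG_simple])
  then obtain a b where ab: "s \<in> TG_verts V E" "t \<in> TG_verts V E" "s \<noteq> t" "a \<in> block s" "b \<in> block t" "{a, b} \<in> E"
    using TG_edges_iff by blast
  \<comment> \<open>The invariant covers whole blocks, since a walk may leave a block at another
    vertex than the one where it entered.\<close>
  have "r \<in> TG_verts V E \<and> (\<forall>y\<in>block r. reach (E - {{a, b}}) a y)"
    if "reach (TG_edges V E - {{s, t}}) s r" for r
    using that
  proof (induction rule: reach_induct)
    case refl
    then show ?case using reach_within_block[OF ab(1-5) ab(1)] ab by blast
  next
    case (step p q)
    then have pq: "{p, q} \<in> TG_edges V E" "{p, q} \<noteq> {s, t}" by auto
    then obtain x y where xy: "p \<in> TG_verts V E" "q \<in> TG_verts V E" "x \<in> block p" "y \<in> block q" "{x, y} \<in> E"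
      using TG_edges_iff by blast
    have "{x, y} \<noteq> {a, b}"
    proof
      assume "{x, y} = {a, b}"
      then have "x = a \<and> y = b \<or> x = b \<and> y = a" unfolding doubleton_eq_iff .
      then have "p = s \<and> q = t \<or> p = t \<and> q = s"
        using block_disjoint[OF xy(1) ab(1)] block_disjoint[OF xy(1) ab(2)]
          block_disjoint[OF xy(2) ab(1)] block_disjoint[OF xy(2) ab(2)] xy(3,4) ab(4,5)
        by blast
      then have "{p, q} = {s, t}" by (simp only: doubleton_eq_iff)
      then show False using pq(2) by blast
    qed
    then have "reach (E - {{a, b}}) x y" using xy(5) by (intro reach_edge) simp
    moreover have "reach (E - {{a, b}}) a x" using step(3) xy(3) by blast
    ultimately have ay: "reach (E - {{a, b}}) a y" by (metis reach_trans)
    have "reach (E - {{a, b}}) a z" if "z \<in> block q" for z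
      by (rule reach_trans[OF ay reach_within_block[OF ab(1-5) xy(2,4) that]])
    then show ?case using xy(2) by blast
  qed
  then have "reach (E - {{a, b}}) a b" using st(2) ab(5) by blast
  then show False using edge_between_blocks_bridge[OF ab] by blast
qed

text \<open>Blocks are disjoint, so a cycle whose own block is kept loses no edge.\<close>

lemma cycles_del_blocks:
  assumes "D \<subseteq> TG_verts V E"
  shows "cycles (del_edges E (\<Union>(block ` D))) = {C \<in> cycles E. Inr C \<notin> D}" (is "cycles ?E = ?R")
proof (rule set_eqI, rule iffI)
  fix C assume C: "C \<in> cycles ?E"
  then have CE: "C \<in> cycles E" using cycles_mono[OF del_edges_subset] by blast
  moreover have "Inr C \<notin> D"
  proof
    assume "Inr C \<in> D"
    then have "cyc_verts C \<subseteq> \<Union>(block ` D)" by force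
    moreover have "\<Union>C \<inter> \<Union>(block ` D) = {}" using cycles_subset[OF C] unfolding del_edges_def by blast
    ultimately show False using cyc_verts_nonempty[OF CE] unfolding cyc_verts_def by blast
  qed
  ultimately show "C \<in> ?R" by blast
next
  fix C assume "C \<in> ?R"
  then have C: "C \<in> cycles E" "Inr C \<notin> D" by auto
  have "cyc_verts C \<inter> block s = {}" if "s \<in> D" for s
  proof (rule ccontr)
    assume "cyc_verts C \<inter> block s \<noteq> {}"
    then obtain a where "a \<in> block (Inr C)" "a \<in> block s" by auto
    then have "Inr C = s" using block_disjoint[of "Inr C" s a] C(1) that assms by (auto simp: Inr_in_TG_verts)
    then show False using C that by blast
  qed
  then have "C \<subseteq> ?E" using cycles_subset[OF C(1)] unfolding del_edges_def cyc_verts_def by blast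
  then show "C \<in> cycles ?E" using C(1) cycles_iff by blast
qed

lemma disjoint_cycles_del: "disjoint_cycles (V - S) (del_edges E S)"
  using simple_graph_del[OF simple] disjoint cycles_mono[OF del_edges_subset]
  by unfold_locales blast+

text \<open>Contraction commutes with deleting whole blocks: cycles disappear only as a whole, so no
  remaining vertex of a cycle turns into a vertex off all cycles. This lets an induction on G speak
  about T_G with vertices deleted.\<close>

lemma TG_del_blocks:
  assumes "D \<subseteq> TG_verts V E" and S: "S = \<Union>(block ` D)"
  shows "TG_verts (V - S) (del_edges E S) = TG_verts V E - D"
    and "TG_edges (V - S) (del_edges E S) = del_edges (TG_edges V E) D"
proof -
  interpret sub: disjoint_cycles "V - S" "del_edges E S" by (rule disjoint_cycles_del)
  have cyc: "cycles (del_edges E S) = {C \<in> cycles E. Inr C \<notin> D}" unfolding S by (rule cycles_del_blocks[OF assms(1)])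
  have dis: "block s \<inter> S = {}" if s: "s \<in> TG_verts V E - D" for s
  proof (rule ccontr)
    assume "block s \<inter> S \<noteq> {}"
    then obtain a t where "a \<in> block s" "a \<in> block t" "t \<in> D" unfolding S by blast
    then show False using block_disjoint[of s t a] s assms(1) by blast
  qed
  have nc: "u \<in> non_cycle_verts (V - S) (del_edges E S) \<longleftrightarrow> u \<in> non_cycle_verts V E \<and> Inl u \<notin> D" for u
  proof
    assume u: "u \<in> non_cycle_verts (V - S) (del_edges E S)"
    then have uV: "u \<in> V" "u \<notin> S" unfolding non_cycle_verts_def by auto
    have "u \<notin> cyc_verts C" if "C \<in> cycles E" for C
    proof
      assume uC: "u \<in> cyc_verts C"
      then have "Inr C \<notin> D" using uV unfolding S by force
      then have "C \<in> cycles (del_edges E S)" using that cyc by blast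
      then show False using u uC unfolding non_cycle_verts_def by blast
    qed
    moreover have "Inl u \<notin> D" using uV unfolding S by force
    ultimately show "u \<in> non_cycle_verts V E \<and> Inl u \<notin> D" using uV unfolding non_cycle_verts_def by blast
  next
    assume u: "u \<in> non_cycle_verts V E \<and> Inl u \<notin> D"
    then have "u \<notin> S" using dis[of "Inl u"] by (simp add: Inl_in_TG_verts)
    then show "u \<in> non_cycle_verts (V - S) (del_edges E S)"
      using u cyc unfolding non_cycle_verts_def by auto
  qed
  show verts: "TG_verts (V - S) (del_edges E S) = TG_verts V E - D"
    unfolding TG_verts_def using nc cyc by auto
  show "TG_edges (V - S) (del_edges E S) = del_edges (TG_edges V E) D"
  proof (rule set_of_doubletons_eqI)
    show "\<exists>s t. e = {s, t}" if "e \<in> TG_edges (V - S) (del_edges E S)" for e using that by (rule TG_edgeE) blast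
    show "\<exists>s t. e = {s, t}" if "e \<in> del_edges (TG_edges V E) D" for e
      using del_edges_subset[THEN subsetD, OF that] by (rule TG_edgeE) blast
    fix s t
    show "{s, t} \<in> TG_edges (V - S) (del_edges E S) \<longleftrightarrow> {s, t} \<in> del_edges (TG_edges V E) D"
    proof
      assume "{s, t} \<in> TG_edges (V - S) (del_edges E S)"
      then show "{s, t} \<in> del_edges (TG_edges V E) D"
        unfolding sub.TG_edges_iff verts doubleton_in_del_edges TG_edges_iff by blast
    next
      assume "{s, t} \<in> del_edges (TG_edges V E) D"
      then show "{s, t} \<in> TG_edges (V - S) (del_edges E S)"
        unfolding sub.TG_edges_iff verts doubleton_in_del_edges TG_edges_iff using dis[of s] dis[of t] by blast
    qed
  qed
qed

text \<open>Written as a deletion, the induced subgraph commutes with further deletions by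
  \<open>del_edges_Un\<close>.\<close>

lemma Gamma_edges_eq: "Gamma_edges V E = del_edges (TG_edges V E) (Inr ` cycles E)"
  using simple_graph_edges_Pow[OF TG_simple] unfolding Gamma_edges_def Gamma_verts_def del_edges_def by blast

lemma Gamma_simple: "simple_graph (Gamma_verts V E) (Gamma_edges V E)"
  unfolding Gamma_edges_eq Gamma_verts_def by (rule simple_graph_del[OF TG_simple])

lemma Gamma_del_blocks:
  assumes "D \<subseteq> TG_verts V E" and S: "S = \<Union>(block ` D)"
  shows "Gamma_verts (V - S) (del_edges E S) = Gamma_verts V E - D"
    and "Gamma_edges (V - S) (del_edges E S) = del_edges (Gamma_edges V E) D"
proof -
  interpret sub: disjoint_cycles "V - S" "del_edges E S" by (rule disjoint_cycles_del)
  have cyc: "cycles (del_edges E S) = {C \<in> cycles E. Inr C \<notin> D}" unfolding S by (rule cycles_del_blocks[OF assms(1)])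
  then have un: "D \<union> Inr ` cycles (del_edges E S) = Inr ` cycles E \<union> D" by auto
  show "Gamma_verts (V - S) (del_edges E S) = Gamma_verts V E - D"
    unfolding Gamma_verts_def TG_del_blocks[OF assms] using un by blast
  show "Gamma_edges (V - S) (del_edges E S) = del_edges (Gamma_edges V E) D"
    unfolding sub.Gamma_edges_eq Gamma_edges_eq TG_del_blocks(2)[OF assms] del_edges_Un un ..
qed

end

section \<open>Pendant cycles\<close>

text \<open>A rotation puts the attachment vertex of a pendant cycle at index 0.\<close>

lemma cycle_list_starting_at:
  assumes "C \<in> cycles E" "x \<in> cyc_verts C"
  obtains vs where "cycle_list E vs" "C = cycle_edges vs" "cyc_nth vs 0 = x"
proof -
  obtain vs where vs: "distinct vs" "length vs \<ge> 3" "C = cycle_edges vs" "C \<subseteq> E" "cyc_verts C = set vs" "vs \<noteq> []"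
    by (rule cyclesE[OF assms(1)])
  obtain j where j: "x = cyc_nth vs j" using in_set_cyc_nth assms(2) vs(5) by metis
  let ?ws = "rotate j vs"
  have ws: "cyc_nth ?ws i = cyc_nth vs (j + i)" for i
    unfolding cyc_nth_def using vs(6) by (simp add: nth_rotate mod_add_right_eq)
  have eq: "cycle_edges ?ws = cycle_edges vs"
  proof -
    have "{cyc_nth vs i, cyc_nth vs (Suc i)} \<in> range (\<lambda>i. {cyc_nth vs (j + i), cyc_nth vs (Suc (j + i))})" for i
    proof -
      obtain n where n: "length vs = Suc n" using vs(6) by (cases vs) auto
      \<comment> \<open>Moving on by \<open>n * j\<close> undoes the rotation by \<open>j\<close>
        modulo the length, without a subtraction.\<close>
      have k: "j + (i + n * j) = i + j * length vs" unfolding n by simp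
      have "{cyc_nth vs i, cyc_nth vs (Suc i)} = {cyc_nth vs (j + (i + n * j)), cyc_nth vs (Suc (j + (i + n * j)))}"
        unfolding cyc_nth_def k by (simp flip: add_Suc)
      then show ?thesis by blast
    qed
    then have "range (\<lambda>i. {cyc_nth vs (j + i), cyc_nth vs (Suc (j + i))}) = range (\<lambda>i. {cyc_nth vs i, cyc_nth vs (Suc i)})"
      by blast
    moreover have "?ws \<noteq> []" using vs(6) by simp
    ultimately show ?thesis using vs(6) by (simp add: cycle_edges_cyc_nth ws)
  qed
  show ?thesis
  proof (rule that)
    show "cycle_list E ?ws" unfolding cycle_list_iff eq using vs by simp
    show "C = cycle_edges ?ws" using eq vs(3) by simp
    show "cyc_nth ?ws 0 = x" using ws[of 0] j by simp
  qed
qed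

text \<open>The last two premises make \<open>as\<close> an entire component that is a path. Each
  pair at its front is a pendant pair worth rank 2, and the single vertex left at the end is worth
  nothing.\<close>

lemma extremal_peel_path:
  assumes "extremal V E \<phi>" "distinct as" "odd (length as)" "set as \<subseteq> V"
    and "\<And>i. Suc i < length as \<Longrightarrow> {as ! i, as ! Suc i} \<in> E"
    and "\<And>e. e \<in> E \<Longrightarrow> e \<inter> set as \<noteq> {} \<Longrightarrow> \<exists>i. Suc i < length as \<and> e = {as ! i, as ! Suc i}"
  shows "extremal (V - set as) (del_edges E (set as)) \<phi> \<and>
    graph_rank V E = graph_rank (V - set as) (del_edges E (set as)) + (length as - 1)"
  using assms
proof (induction "length as" arbitrary: as V E rule: less_induct)
  case less
  note sg = extremal_simple[OF less.prems(1)]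
  obtain a as' where as: "as = a # as'" using less.prems(3) by (cases as) auto
  show ?case
  proof (cases as')
    case Nil
    then have as: "as = [a]" using as by simp
    have iso: "a \<notin> e" if "e \<in> E" for e using less.prems(6)[OF that] as by auto
    have a: "a \<in> V" using less.prems(4) as by simp
    show ?thesis
      using extremal_isolated[OF less.prems(1) a iso] graph_rank_isolated[OF sg a iso] as by simp
  next
    case (Cons b r)
    then have as: "as = a # b # r" using as by simp
    have ba: "{b, a} \<in> E" using less.prems(5)[of 0] as by (simp add: insert_commute)
    have pend: "e = {b, a}" if e: "e \<in> E" "a \<in> e" for e
    proof -
      obtain i where i: "Suc i < length as" "e = {as ! i, as ! Suc i}"
        using less.prems(6)[OF e(1)] e(2) as by auto
      \<comment> \<open>By distinctness the end vertex \<open>a\<close> occurs only at index 0, so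
        the first path edge is its only edge.\<close>
      have neq: "as ! Suc j \<noteq> a" if "Suc j < length as" for j
        using nth_mem[of j "b # r"] that less.prems(2) unfolding as by auto
      have "as ! i = a" using e(2) i(2) neq[OF i(1)] by auto
      then have "i = 0" using neq i(1) by (cases i) auto
      then show ?thesis using i as by (simp add: insert_commute)
    qed
    let ?V = "V - {b, a}" and ?E = "del_edges E {b, a}"
    have IH: "extremal (?V - set r) (del_edges ?E (set r)) \<phi> \<and>
      graph_rank ?V ?E = graph_rank (?V - set r) (del_edges ?E (set r)) + (length r - 1)"
    proof (rule less.hyps)
      show "length r < length as" using as by simp
      show "extremal ?V ?E \<phi>" by (rule extremal_pendant(1)[OF less.prems(1) ba pend])
      show "distinct r" "odd (length r)" "set r \<subseteq> ?V" using less.prems(2-4) as by auto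
      show "{r ! i, r ! Suc i} \<in> ?E" if "Suc i < length r" for i
      proof -
        have "{r ! i, r ! Suc i} \<in> E" using less.prems(5)[of "Suc (Suc i)"] that as by simp
        moreover have "r ! i \<in> set r" "r ! Suc i \<in> set r" using that by auto
        ultimately show ?thesis using less.prems(2) as by (auto simp: doubleton_in_del_edges)
      qed
      show "\<exists>i. Suc i < length r \<and> e = {r ! i, r ! Suc i}" if e: "e \<in> ?E" "e \<inter> set r \<noteq> {}" for e
      proof -
        have e': "e \<in> E" "a \<notin> e" "b \<notin> e" using e(1) unfolding del_edges_def by auto
        then obtain i where i: "Suc i < length as" "e = {as ! i, as ! Suc i}"
          using less.prems(6)[of e] e(2) as by auto
        have "i \<noteq> 0" using i e'(2) as by auto
        moreover have "i \<noteq> 1" using i e'(3) as by auto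
        ultimately obtain k where k: "i = Suc (Suc k)" by (metis One_nat_def not0_implies_Suc)
        show ?thesis by (rule exI[of _ k]) (use i as k in simp)
      qed
    qed
    have 1: "?V - set r = V - set as" using as by auto
    have 2: "del_edges ?E (set r) = del_edges E (set as)" using as by (simp add: del_edges_Un insert_commute)
    have "odd (length r)" using less.prems(3) as by simp
    then have "length as - 1 = length r - 1 + 2" using as by (cases r) auto
    then show ?thesis using IH graph_rank_pendant[OF sg ba pend] unfolding 1 2 by simp
  qed
qed

text \<open>Deleting the attachment vertex costs rank 2, and the odd path that remains is worth
  \<open>length vs - 2\<close>. The third claim keeps of the cycle only its attachment vertex, which
  can then be dropped for free because a kernel vector nonzero there survives the
  restriction.\<close>

lemma extremal_end_cycle:
  assumes ext: "extremal V E \<phi>" and cyc: "cycle_list E vs"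
    and edges_at: "\<forall>v\<in>set vs - {cyc_nth vs 0}. {e \<in> E. v \<in> e} \<subseteq> cycle_edges vs"
  shows "extremal (V - set vs) (del_edges E (set vs)) \<phi>"
    and "graph_rank V E = graph_rank (V - set vs) (del_edges E (set vs)) + length vs"
    and "gain_rank (V - (set vs - {cyc_nth vs 0})) (del_edges E (set vs - {cyc_nth vs 0})) \<phi>
      = gain_rank (V - set vs) (del_edges E (set vs)) \<phi>"
proof -
  note gg = extremal_gain_graph[OF ext] and sg = extremal_simple[OF ext]
  have vs: "distinct vs" "length vs \<ge> 3" "vs \<noteq> []" "cycle_edges vs \<subseteq> E"
    using cyc unfolding cycle_list_iff by auto
  have C: "cycle_edges vs \<in> cycles E" using cyc unfolding cycles_def by blast
  have verts: "cyc_verts (cycle_edges vs) = set vs" by (rule cyc_verts_cycle_edges[OF vs(3)])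
  have sub: "set vs \<subseteq> V" using cyc_verts_subset[OF sg C] verts by simp
  have nbr: "e \<in> cycle_edges vs" if "v \<in> set vs" "v \<noteq> cyc_nth vs 0" "e \<in> E" "v \<in> e" for v e
    using edges_at that by blast
  define x where "x = cyc_nth vs 0"
  obtain ws where ws: "vs = x # ws"
    using vs(3) unfolding x_def cyc_nth_def by (cases vs) auto
  have tl: "set ws = set vs - {x}" "x \<notin> set ws" "insert x (set ws) = set vs" "x \<in> set vs"
    using vs(1) ws by auto
  have type: "type_A \<phi> vs" "length vs mod 4 = 2" using extremal_cycle_type[OF ext cyc] by auto
  have even: "even (length vs)" using type(2) by presburger
  have xC: "x \<in> cyc_verts (cycle_edges vs)" using tl verts by simp
  note del = extremal_delete_cycle_vertex[OF ext C xC]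
  have nth: "ws ! i = cyc_nth vs (Suc i)" if "i < length ws" for i
    using that ws unfolding cyc_nth_def by simp
  have peel: "extremal (V - {x} - set ws) (del_edges (del_edges E {x}) (set ws)) \<phi> \<and>
    graph_rank (V - {x}) (del_edges E {x}) =
      graph_rank (V - {x} - set ws) (del_edges (del_edges E {x}) (set ws)) + (length ws - 1)"
  proof (rule extremal_peel_path[OF del(1)])
    show "distinct ws" using vs(1) ws by simp
    show "odd (length ws)" using even ws by simp
    show "set ws \<subseteq> V - {x}" using tl sub by blast
    show "{ws ! i, ws ! Suc i} \<in> del_edges E {x}" if i: "Suc i < length ws" for i
    proof -
      have "ws ! i \<in> set ws" "ws ! Suc i \<in> set ws" using i by auto
      then have "ws ! i \<noteq> x" "ws ! Suc i \<noteq> x" using tl(2) by auto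
      moreover have "{cyc_nth vs (Suc i), cyc_nth vs (Suc (Suc i))} \<in> E"
        using vs(4) cycle_edges_cyc_nth[OF vs(3)] by blast
      ultimately show ?thesis using i nth[of i] nth[of "Suc i"] by (simp add: doubleton_in_del_edges)
    qed
    show "\<exists>i. Suc i < length ws \<and> e = {ws ! i, ws ! Suc i}"
      if e: "e \<in> del_edges E {x}" "e \<inter> set ws \<noteq> {}" for e
    proof -
      have eE: "e \<in> E" "x \<notin> e" using e(1) unfolding del_edges_def by auto
      obtain v where "v \<in> e" "v \<in> set vs" "v \<noteq> x" using e(2) tl(1) by blast
      then have "e \<in> cycle_edges vs" using nbr eE unfolding x_def by blast
      then obtain i where i: "i < length vs" "e = {vs ! i, vs ! ((i + 1) mod length vs)}"
        unfolding cycle_edges_def by blast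
      have x0: "vs ! 0 = x" using ws by simp
      have "i \<noteq> 0"
      proof
        assume "i = 0"
        then have "vs ! 0 \<in> e" using i(2) by simp
        then show False using eE(2) x0 by simp
      qed
      moreover have "i + 1 \<noteq> length vs"
      proof
        assume "i + 1 = length vs"
        then have "vs ! 0 \<in> e" using i(2) by simp
        then show False using eE(2) x0 by simp
      qed
      ultimately obtain k where k: "i = Suc k" "Suc (Suc k) < length vs" using i(1) by (cases i) auto
      show ?thesis by (rule exI[of _ k]) (use i k ws in simp)
    qed
  qed
  have sets: "V - {x} - set ws = V - set vs" "del_edges (del_edges E {x}) (set ws) = del_edges E (set vs)"
    using tl by (auto simp: del_edges_Un)
  show "extremal (V - set vs) (del_edges E (set vs)) \<phi>" using peel unfolding sets by blast
  show "graph_rank V E = graph_rank (V - set vs) (del_edges E (set vs)) + length vs"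
    using peel del(3) vs(2) ws unfolding sets by simp
  obtain c where c: "in_kernel V (gain_adj_mat E \<phi>) c" "c x \<noteq> 0" by (rule extremal_kernel_vector[OF ext C xC])
  let ?A = "gain_adj_mat E \<phi>" and ?g = "cyc_gain_nth \<phi> vs"
  define m where "m = length vs div 2 - 1"
  have m: "length vs = 2 * Suc m" using even vs(2) unfolding m_def by auto
  have nbr': "{cyc_nth vs (Suc i), w} \<in> cycle_edges vs"
    if "Suc i < length vs" "{cyc_nth vs (Suc i), w} \<in> E" for i w
  proof (rule nbr[OF cyc_nth_in_set[OF vs(3)] _ that(2)])
    show "cyc_nth vs (Suc i) \<noteq> cyc_nth vs 0" unfolding cyc_nth_eq_iff[OF vs(1,3)] using that(1) by simp
  qed simp
  \<comment> \<open>The rows of the other vertices of the cycle, together with type A, force the cycle part of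
    row x to vanish; so the rest of row x vanishes, too.\<close>
  let ?a = "cyc_nth vs 1" and ?b = "cyc_nth vs (length vs - 1)"
  have rowx: "c ?a * \<phi> x ?a + c ?b * \<phi> x ?b = 0"
  proof -
    let ?P = "\<Prod>l<2 * m. ?g (1 + l)"
    have last: "1 + 2 * m = length vs - 1" using m by simp
    have "c ?a = (-1) ^ m * ?P * c (cyc_nth vs (1 + 2 * m))"
    proof (rule two_step_recurrence[of m "\<lambda>i. c (cyc_nth vs i)" 1 ?g])
      fix k assume "k < m"
      then have "Suc (1 + 2 * k) < length vs" using m by simp
      then show "c (cyc_nth vs (1 + 2 * k)) =
          - (?g (1 + 2 * k) * ?g (Suc (1 + 2 * k))) * c (cyc_nth vs (Suc (Suc (1 + 2 * k))))"
        by (intro cycle_kernel_step[OF gg cyc _ c(1)] nbr')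
    qed
    then have 1: "c ?a = (-1) ^ m * ?P * c ?b" unfolding last .
    have "Suc (length vs - 1) = length vs" using vs(2) by simp
    then have wrap: "cyc_nth vs (Suc (length vs - 1)) = x" unfolding x_def cyc_nth_def by (metis mod_self mod_0)
    \<comment> \<open>The full gain is the product along the path avoiding \<open>x\<close>, flanked
      by the edge leaving \<open>x\<close> and the edge returning to it.\<close>
    have "cycle_gain \<phi> vs = ?g 0 * ?P * ?g (1 + 2 * m)"
    proof -
      have len: "length vs = Suc (Suc (2 * m))" using m by simp
      have "prod ?g {..<Suc (2 * m)} = ?g 0 * ?P"
        unfolding plus_1_eq_Suc by (rule prod.lessThan_Suc_shift)
      then show ?thesis
        unfolding cycle_gain_eq len plus_1_eq_Suc prod.lessThan_Suc[of _ "Suc (2 * m)"] by (rule arg_cong)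
    qed
    moreover have "cycle_gain \<phi> vs = (-1) ^ Suc m" using type(1) m unfolding type_A_def by simp
    ultimately have "?g 0 * ?P * ?g (length vs - 1) = - ((-1) ^ m)" unfolding last by simp
    moreover have "?g 0 = \<phi> x ?a" unfolding x_def by simp
    ultimately have 2: "\<phi> x ?a * ?P * \<phi> ?b x = - ((-1) ^ m)" unfolding wrap by simp
    have "{?b, cyc_nth vs (Suc (length vs - 1))} \<in> E"
      using vs(4) cycle_edges_cyc_nth[OF vs(3)] by blast
    then have 3: "\<phi> ?b x * \<phi> x ?b = 1" unfolding wrap by (rule gain_graph_unit(1)[OF gg])
    have 4: "(-1) ^ m * (-1) ^ m = (1::complex)" by (simp flip: power_add mult_2)
    have "c ?a * \<phi> x ?a = (-1) ^ m * (\<phi> x ?a * ?P) * c ?b" unfolding 1 by (simp add: mult_ac)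
    also have "\<phi> x ?a * ?P = \<phi> x ?a * ?P * (\<phi> ?b x * \<phi> x ?b)" unfolding 3 by simp
    also have "\<dots> = (\<phi> x ?a * ?P * \<phi> ?b x) * \<phi> x ?b" by (simp only: mult_ac)
    also have "\<dots> = - ((-1) ^ m) * \<phi> x ?b" unfolding 2 ..
    also have "(-1) ^ m * (- ((-1) ^ m) * \<phi> x ?b) * c ?b = - (((-1) ^ m * (-1) ^ m) * (c ?b * \<phi> x ?b))"
      by (simp add: mult_ac)
    finally show ?thesis unfolding 4 by simp
  qed
  let ?W = "V - set ws"
  have fin: "finite V" by (rule simple_graph_finite[OF sg])
  have ker: "in_kernel ?W ?A c"
    unfolding in_kernel_def
  proof
    fix u assume u: "u \<in> ?W"
    have "(\<Sum>v\<in>V. c v * ?A u v) = 0" using c(1) u unfolding in_kernel_def by blast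
    moreover have "(\<Sum>v\<in>V. c v * ?A u v) = (\<Sum>v\<in>?W. c v * ?A u v) + (\<Sum>v\<in>set ws. c v * ?A u v)"
      by (rule sum.subset_diff) (use sub tl fin in auto)
    \<comment> \<open>The removed vertices contribute nothing: in row \<open>x\<close> because of
      \<open>rowx\<close>, in every other row because no edge leads to them.\<close>
    moreover have "(\<Sum>v\<in>set ws. c v * ?A u v) = 0"
    proof (cases "u = x")
      case True
      have ab: "?a \<in> set ws" "?b \<in> set ws" "?a \<noteq> ?b"
      proof -
        show "?a \<noteq> ?b" unfolding cyc_nth_eq_iff[OF vs(1,3)] using vs(2) by simp
        have "?a \<noteq> x" "?b \<noteq> x" unfolding x_def cyc_nth_eq_iff[OF vs(1,3)] using vs(2) by auto
        then show "?a \<in> set ws" "?b \<in> set ws" using cyc_nth_in_set[OF vs(3)] tl(1) by auto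
      qed
      \<comment> \<open>Neighbours are taken at index \<open>Suc (length vs - 1)\<close>, which
        wraps around to \<open>x\<close>.\<close>
      have iff: "{x, w} \<in> cycle_edges vs \<longleftrightarrow> w = ?b \<or> w = ?a" for w
      proof -
        have s: "Suc (length vs - 1) = length vs" using vs(2) by simp
        have "cyc_nth vs (Suc (length vs - 1)) = x" "cyc_nth vs (Suc (Suc (length vs - 1))) = ?a"
          using vs(2) unfolding s x_def cyc_nth_def by (auto simp: mod_Suc)
        then show ?thesis using cyc_nth_neighbours[OF vs(1,2), of "length vs - 1" w] by simp
      qed
      have "(\<Sum>v\<in>set ws. c v * ?A x v) = (\<Sum>v\<in>{?a, ?b}. c v * \<phi> x v)"
      proof (rule sum.mono_neutral_cong_right)
        show "\<forall>v\<in>set ws - {?a, ?b}. c v * ?A x v = 0"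
        proof
          fix v assume v: "v \<in> set ws - {?a, ?b}"
          have "{x, v} \<notin> E"
          proof
            assume "{x, v} \<in> E"
            then have "{x, v} \<in> cycle_edges vs" using nbr[of v "{x, v}"] v tl(1) unfolding x_def by blast
            then show False using iff v by blast
          qed
          then show "c v * ?A x v = 0" by (simp add: gain_adj_mat_def)
        qed
        show "c v * ?A x v = c v * \<phi> x v" if "v \<in> {?a, ?b}" for v
        proof -
          have "{x, v} \<in> E" using that iff[of v] vs(4) by blast
          then show ?thesis by (simp add: gain_adj_mat_def)
        qed
      qed (use ab in auto)
      then show ?thesis using True rowx ab(3) by simp
    next
      case False
      then have "u \<notin> set vs" using u tl(1) by blast
      have "{u, v} \<notin> E" if "v \<in> set ws" for v
      proof
        assume "{u, v} \<in> E"
        then have "{u, v} \<in> cycle_edges vs" using nbr[of v "{u, v}"] that tl(1) unfolding x_def by blast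
        then show False using \<open>u \<notin> set vs\<close> verts unfolding cyc_verts_def by blast
      qed
      then show ?thesis by (intro sum.neutral) (simp add: gain_adj_mat_def)
    qed
    ultimately show "(\<Sum>v\<in>?W. c v * ?A u v) = 0" by simp
  qed
  have "mat_rank (?W - {x}) ?A = mat_rank ?W ?A"
    by (rule rank_delete_eq_if_kernel_vector[where c = c])
      (use fin tl sub ker c(2) gain_graph_hermitian[OF gg] in auto)
  moreover have "?W - {x} = V - set vs" using tl by blast
  ultimately show "gain_rank (V - (set vs - {cyc_nth vs 0})) (del_edges E (set vs - {cyc_nth vs 0})) \<phi>
      = gain_rank (V - set vs) (del_edges E (set vs)) \<phi>"
    unfolding gain_rank_del tl(1) x_def by simp
qed

section \<open>Rank of the contracted graph\<close>

lemma extremal_disjoint_cycles: "extremal V E \<phi> \<Longrightarrow> disjoint_cycles V E"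
  by unfold_locales (blast dest: extremal_simple extremal_cycles_disjoint)+

lemma card_cyc_verts: "cycle_list E vs \<Longrightarrow> card (cyc_verts (cycle_edges vs)) = length vs"
  using cyc_verts_cycle_edges[of vs] unfolding cycle_list_iff by (cases vs) (auto simp: distinct_card)

text \<open>Both equations are proved together: for a pendant cycle, the second one is obtained from
  the rank formula at two smaller graphs.\<close>

lemma extremal_contraction_rank:
  assumes "extremal V E \<phi>"
  shows "graph_rank V E = graph_rank (TG_verts V E) (TG_edges V E) + (\<Sum>C\<in>cycles E. card (cyc_verts C))
    \<and> graph_rank (TG_verts V E) (TG_edges V E) = graph_rank (Gamma_verts V E) (Gamma_edges V E)"
  using assms
proof (induction "card V" arbitrary: V E rule: less_induct)
  case less
  note ext = less.prems
  note sg = extremal_simple[OF ext]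
  interpret disjoint_cycles V E by (rule extremal_disjoint_cycles[OF ext])
  let ?TV = "TG_verts V E" and ?TE = "TG_edges V E" and ?GV = "Gamma_verts V E" and ?GE = "Gamma_edges V E"
  let ?c = "\<lambda>C. card (cyc_verts C)"
  \<comment> \<open>The hypothesis is restated for deleting a nonempty set \<open>D\<close> of
    blocks, with T_G and Gamma_G of the smaller graph rewritten as deletions of
    \<open>D\<close>.\<close>
  have IH: "graph_rank (V - S) (del_edges E S) =
        graph_rank (?TV - D) (del_edges ?TE D) + (\<Sum>C\<in>{C \<in> cycles E. Inr C \<notin> D}. ?c C)
      \<and> graph_rank (?TV - D) (del_edges ?TE D) = graph_rank (?GV - D) (del_edges ?GE D)"
    if D: "D \<subseteq> ?TV" "D \<noteq> {}" "S = \<Union>(block ` D)" "extremal (V - S) (del_edges E S) \<phi>" for D S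
  proof -
    obtain s where s: "s \<in> D" using D(2) by blast
    then have sT: "s \<in> ?TV" using D(1) by blast
    obtain v where v: "v \<in> block s" using block_nonempty[OF sT] by blast
    have "v \<in> V" "v \<in> S" using v s block_subset[OF sT] D(3) by auto
    from less.hyps[OF card_del_less[OF sg this] D(4)] show ?thesis
      unfolding TG_del_blocks[OF D(1,3)] Gamma_del_blocks[OF D(1,3)] cycles_del_blocks[OF D(1), folded D(3)] .
  qed
  show ?case
  proof (cases "?TV = {}")
    case True
    then have "V = {}" using block_cover by blast
    moreover have "?GV = {}" using True unfolding Gamma_verts_def by simp
    moreover have "cycles E = {}" using True unfolding TG_verts_def by blast
    ultimately show ?thesis
      using graph_rank_le_card[of V E] graph_rank_le_card[of ?TV ?TE] graph_rank_le_card[of ?GV ?GE] True by simp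
  next
    case False
    obtain s where s: "s \<in> ?TV" "card {e \<in> ?TE. s \<in> e} \<le> 1"
      by (rule theta_zero_leaf[OF TG_simple TG_forest False])
    \<comment> \<open>Edges leaving the block of \<open>s\<close> lead to neighbours of
      \<open>s\<close> in T_G, so the degree in T_G controls the edges of G.\<close>
    have out: "\<exists>t. t \<in> ?TV \<and> w \<in> block t \<and> (t = s \<or> {s, t} \<in> ?TE)" if aw: "a \<in> block s" "{a, w} \<in> E" for a w
    proof -
      have "w \<in> V" using simple_graphD[OF sg aw(2)] by blast
      then obtain t where t: "t \<in> ?TV" "w \<in> block t" by (rule block_cover)
      then show ?thesis using TG_edges_iff[of s t] s(1) aw by blast
    qed
    from s(1) show ?thesis
    proof (cases rule: TG_vertsE)
      case u: (Inl u)
      have out_u: "\<exists>t. t \<in> ?TV \<and> w \<in> block t \<and> {s, t} \<in> ?TE" if w: "{u, w} \<in> E" for w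
        using out[of u w] w u(1) simple_graphD(3)[OF sg w] by auto
      have cycles_eq: "{C \<in> cycles E. Inr C \<notin> D} = cycles E" if "D \<subseteq> range Inl" for D :: "('a + 'a set set) set"
        using that by blast
      have uG: "s \<in> ?GV" using s(1) u(1) unfolding Gamma_verts_def by auto
      from TG_simple s(2) show ?thesis
      proof (cases rule: degree_le_1_cases)
        case isolated
        have iso: "u \<notin> e" if e: "e \<in> E" for e
        proof
          assume "u \<in> e"
          then obtain w where "e = {u, w}" by (rule simple_graph_edge_atE[OF sg e])
          then show False using out_u[of w] e isolated by blast
        qed
        have isoG: "s \<notin> e" if "e \<in> ?GE" for e
          using that isolated unfolding Gamma_edges_def by blast
        have "graph_rank (V - {u}) (del_edges E {u}) =
            graph_rank (?TV - {s}) (del_edges ?TE {s}) + (\<Sum>C\<in>{C \<in> cycles E. Inr C \<notin> {s}}. ?c C)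
          \<and> graph_rank (?TV - {s}) (del_edges ?TE {s}) = graph_rank (?GV - {s}) (del_edges ?GE {s})"
          by (rule IH) (use s(1) u(1) extremal_isolated[OF ext u(2) iso] in auto)
        then show ?thesis
          using graph_rank_isolated[OF sg u(2) iso] graph_rank_isolated[OF TG_simple s(1) isolated]
            graph_rank_isolated[OF Gamma_simple uG isoG] cycles_eq[of "{s}"] u(1) by simp
      next
        case (pendant t)
        have nb: "\<exists>a\<in>block t. {a, u} \<in> E" and t: "t \<in> ?TV" "t \<noteq> s"
          using pendant(1) u(1) unfolding TG_edges_iff by auto
        have to_t: "w \<in> block t" if w: "{u, w} \<in> E" for w
        proof -
          obtain t' where t': "w \<in> block t'" "{s, t'} \<in> ?TE" using out_u[OF w] by blast
          then have "{s, t'} = {t, s}" using pendant(2)[of "{s, t'}"] by simp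
          then have "t' = t" using t(2) by (metis doubleton_eq_iff)
          then show ?thesis using t' by simp
        qed
        from nb obtain w where w: "w \<in> block t" "{w, u} \<in> E" by blast
        have pend: "e = {w, u}" if e: "e \<in> E" "u \<in> e" for e
        proof -
          obtain w' where w': "e = {u, w'}" by (rule simple_graph_edge_atE[OF sg e])
          then have "w' \<in> block t" "{w', u} \<in> E" using to_t[of w'] e(1) by (auto simp: insert_commute)
          then have "w' = w" using edge_between_blocks_unique[OF t(1) s(1) t(2) w(1) _ w(2), of w' u] u(1) by simp
          then show ?thesis using w' by (simp add: insert_commute)
        qed
        from t(1) show ?thesis
        proof (cases rule: TG_vertsE)
          case (Inr C)
          \<comment> \<open>The neighbour of a pendant vertex lies on no cycle, so \<open>t\<close>
            is not a contracted cycle.\<close>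
          then show ?thesis using extremal_pendant(2)[OF ext w(2) pend Inr(2)] w(1) by simp
        next
          case (Inl w0)
          then have tw: "t = Inl w" using w(1) by simp
          have tG: "t \<in> ?GV" using t(1) tw unfolding Gamma_verts_def by auto
          have eG: "{t, s} \<in> ?GE" using pendant(1) tG uG unfolding Gamma_edges_def by simp
          have pendG: "e = {t, s}" if "e \<in> ?GE" "s \<in> e" for e
            using that pendant(2)[of e] unfolding Gamma_edges_def by simp
          have "graph_rank (V - {w, u}) (del_edges E {w, u}) =
              graph_rank (?TV - {t, s}) (del_edges ?TE {t, s}) + (\<Sum>C\<in>{C \<in> cycles E. Inr C \<notin> {t, s}}. ?c C)
            \<and> graph_rank (?TV - {t, s}) (del_edges ?TE {t, s}) = graph_rank (?GV - {t, s}) (del_edges ?GE {t, s})"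
            by (rule IH) (use s(1) t(1) u(1) tw extremal_pendant(1)[OF ext w(2) pend] in auto)
          then show ?thesis
            using graph_rank_pendant[OF sg w(2) pend] graph_rank_pendant[OF TG_simple pendant]
              graph_rank_pendant[OF Gamma_simple eG pendG] cycles_eq[of "{t, s}"] u(1) tw by simp
        qed
      qed
    next
      case C: (Inr C)
      have inner: "e \<in> C" if "a \<in> cyc_verts C" "b \<in> cyc_verts C" "e = {a, b}" "e \<in> E" for a b e
        using chord_in_cycle[OF C(2) that(1,2)] that(3,4) by simp
      \<comment> \<open>Gamma_G has no contracted cycles among its vertices, so deleting
        \<open>s\<close> leaves it unchanged.\<close>
      have GV: "?GV - {s} = ?GV" and GE: "del_edges ?GE {s} = ?GE"
        using C unfolding Gamma_verts_def Gamma_edges_def del_edges_def by auto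
      have sum_C: "(\<Sum>D\<in>cycles E. ?c D) = ?c C + (\<Sum>D\<in>{D \<in> cycles E. Inr D \<notin> {s}}. ?c D)"
      proof -
        have "{D \<in> cycles E. Inr D \<notin> {s}} = cycles E - {C}" using C(1) by auto
        then show ?thesis using sum.remove[OF finite_cycles[OF sg] C(2)] by simp
      qed
      have IH_C: "graph_rank V E = graph_rank (?TV - {s}) (del_edges ?TE {s}) + (\<Sum>D\<in>cycles E. ?c D)
          \<and> graph_rank (?TV - {s}) (del_edges ?TE {s}) = graph_rank ?GV ?GE"
        if vs: "cycle_list E vs" "C = cycle_edges vs"
          and H: "extremal (V - set vs) (del_edges E (set vs)) \<phi>"
            "graph_rank V E = graph_rank (V - set vs) (del_edges E (set vs)) + length vs" for vs
      proof -
        have "vs \<noteq> []" using vs(1) unfolding cycle_list_iff by auto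
        then have set_vs: "set vs = cyc_verts C" using cyc_verts_cycle_edges[of vs] vs(2) by metis
        have "graph_rank (V - set vs) (del_edges E (set vs)) =
            graph_rank (?TV - {s}) (del_edges ?TE {s}) + (\<Sum>D\<in>{D \<in> cycles E. Inr D \<notin> {s}}. ?c D)
          \<and> graph_rank (?TV - {s}) (del_edges ?TE {s}) = graph_rank (?GV - {s}) (del_edges ?GE {s})"
          by (rule IH) (use s(1) C(1) set_vs H(1) in auto)
        then show ?thesis using H(2) card_cyc_verts[OF vs(1)] vs(2) sum_C unfolding GV GE by simp
      qed
      from TG_simple s(2) show ?thesis
      proof (cases rule: degree_le_1_cases)
        case isolated
        obtain x where x: "x \<in> cyc_verts C" using cyc_verts_nonempty[OF C(2)] by blast
        obtain vs where vs: "cycle_list E vs" "C = cycle_edges vs" "cyc_nth vs 0 = x"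
          by (rule cycle_list_starting_at[OF C(2) x])
        have "vs \<noteq> []" using vs(1) unfolding cycle_list_iff by auto
        then have set_vs: "set vs = cyc_verts C" using cyc_verts_cycle_edges[of vs] vs(2) by metis
        have edge: "e \<in> cycle_edges vs" if e: "v \<in> set vs" "e \<in> E" "v \<in> e" for v e
        proof -
          obtain w where w: "e = {v, w}" by (rule simple_graph_edge_atE[OF sg e(2,3)])
          then obtain t where "w \<in> block t" "t = s \<or> {s, t} \<in> ?TE"
            using out[of v w] e C(1) set_vs by auto
          then have "w \<in> cyc_verts C" using isolated[of "{s, t}"] C(1) by auto
          then show ?thesis using inner[of v w e] e w set_vs vs(2) by simp
        qed
        have nbr: "\<forall>v\<in>set vs - {cyc_nth vs 0}. {e \<in> E. v \<in> e} \<subseteq> cycle_edges vs"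
          using edge by blast
        show ?thesis
          using IH_C[OF vs(1,2) extremal_end_cycle(1,2)[OF ext vs(1) nbr]]
            graph_rank_isolated[OF TG_simple s(1) isolated] by simp
      next
        case (pendant t)
        have t: "t \<in> ?TV" "t \<noteq> s" using pendant(1) unfolding TG_edges_iff by auto
        obtain y x where yx: "y \<in> block t" "x \<in> block s" "{y, x} \<in> E"
          using pendant(1) unfolding TG_edges_iff by auto
        have xC: "x \<in> cyc_verts C" using yx(2) C(1) by simp
        obtain vs where vs: "cycle_list E vs" "C = cycle_edges vs" "cyc_nth vs 0 = x"
          by (rule cycle_list_starting_at[OF C(2) xC])
        have "vs \<noteq> []" using vs(1) unfolding cycle_list_iff by auto
        then have set_vs: "set vs = cyc_verts C" using cyc_verts_cycle_edges[of vs] vs(2) by metis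
        have edge: "e \<in> cycle_edges vs \<or> v = x \<and> e = {y, x}" if e: "v \<in> set vs" "e \<in> E" "v \<in> e" for v e
        proof -
          obtain w where w: "e = {v, w}" by (rule simple_graph_edge_atE[OF sg e(2,3)])
          then obtain r where r: "w \<in> block r" "r = s \<or> {s, r} \<in> ?TE"
            using out[of v w] e C(1) set_vs by auto
          show ?thesis
          proof (cases "r = s")
            case True
            then show ?thesis using r(1) inner[of v w e] e w set_vs vs(2) C(1) by simp
          next
            case False
            then have "{s, r} = {t, s}" using r(2) pendant(2)[of "{s, r}"] by simp
            then have "r = t" using t(2) by (metis doubleton_eq_iff)
            then have "w = y \<and> v = x"
              using edge_between_blocks_unique[OF t(1) s(1) t(2) yx, of w v] r(1) e w C(1) set_vs
              by (simp add: insert_commute)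
            then show ?thesis using w by (simp add: insert_commute)
          qed
        qed
        have nbr: "\<forall>v\<in>set vs - {cyc_nth vs 0}. {e \<in> E. v \<in> e} \<subseteq> cycle_edges vs"
          using edge vs(3) by blast
        note end_cycle = extremal_end_cycle[OF ext vs(1) nbr]
        note H = IH_C[OF vs(1,2) end_cycle(1,2)]
        let ?V = "V - set vs" and ?E = "del_edges E (set vs)"
        have y: "y \<in> V" "y \<notin> set vs"
        proof -
          show "y \<in> V" using simple_graphD[OF sg yx(3)] by blast
          show "y \<notin> set vs" using block_disjoint[OF t(1) s(1) yx(1)] t(2) C(1) set_vs by auto
        qed
        have x: "x \<in> set vs" using xC set_vs by simp
        let ?P = "set vs - {x}"
        \<comment> \<open>With the rest of the cycle gone, \<open>x\<close> is pendant at
          \<open>y\<close>, and removing the pair costs 2; by \<open>end_cycle(3)\<close> the gain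
          rank is the same with \<open>x\<close> as without it.\<close>
        have gain: "gain_rank ?V ?E \<phi> = gain_rank (?V - {y}) (del_edges ?E {y}) \<phi> + 2"
        proof -
          have "{y, x} \<in> del_edges E ?P" using yx(3) y(2) by (simp add: doubleton_in_del_edges)
          moreover have "e = {y, x}" if "e \<in> del_edges E ?P" "x \<in> e" for e
          proof -
            have e: "e \<in> E" "e \<inter> ?P = {}" using that(1) unfolding del_edges_def by auto
            have "e \<notin> cycle_edges vs"
            proof
              assume "e \<in> cycle_edges vs"
              then have "e \<subseteq> set vs" using set_vs vs(2) unfolding cyc_verts_def by blast
              then have "e = {x}" using e(2) that(2) by blast
              then show False using simple_graphD(3)[OF sg, of x x] e(1) by simp
            qed
            then show ?thesis using edge[OF x e(1) that(2)] by blast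
          qed
          ultimately have "gain_rank (V - ?P) (del_edges E ?P) \<phi> =
              gain_rank (V - ?P - {y, x}) (del_edges (del_edges E ?P) {y, x}) \<phi> + 2"
            by (rule gain_rank_pendant[OF gain_graph_del[OF extremal_gain_graph[OF ext]]])
          moreover have "V - ?P - {y, x} = ?V - {y}" using x by auto
          moreover have "?P \<union> {y, x} = set vs \<union> {y}" using x by auto
          ultimately show ?thesis using end_cycle(3) vs(3) by (simp add: del_edges_Un)
        qed
        \<comment> \<open>A cycle through \<open>y\<close> avoids the removed one and survives in
          the extremal rest, where deleting \<open>y\<close> would not change the gain rank, against
          \<open>gain\<close>.\<close>
        have y_off: "y \<notin> cyc_verts D" if D: "D \<in> cycles E" for D
        proof
          assume yD: "y \<in> cyc_verts D"
          then have "D \<noteq> C" using y(2) set_vs by blast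
          then have "cyc_verts D \<inter> set vs = {}" using disjoint[OF D C(2)] set_vs by simp
          then have "D \<subseteq> ?E" using cycles_subset[OF D] unfolding del_edges_def cyc_verts_def by blast
          then have "D \<in> cycles ?E" using D cycles_iff by blast
          then show False using extremal_delete_cycle_vertex(2)[OF end_cycle(1) _ yD] gain by simp
        qed
        from t(1) have ty: "t = Inl y" by (cases rule: TG_vertsE) (use yx(1) y_off in auto)
        have yV: "{y} \<subseteq> ?V" using y by simp
        note Hy = extremal_delete_set[OF end_cycle(1) yV gain graph_rank_le_del[OF extremal_simple[OF end_cycle(1)]]]
        have Vy: "?V - {y} = V - (insert y (set vs))" and Ey: "del_edges ?E {y} = del_edges E (insert y (set vs))"
          by (auto simp: del_edges_Un)
        have "graph_rank (V - insert y (set vs)) (del_edges E (insert y (set vs))) =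
            graph_rank (?TV - {t, s}) (del_edges ?TE {t, s}) + (\<Sum>D\<in>{D \<in> cycles E. Inr D \<notin> {t, s}}. ?c D)
          \<and> graph_rank (?TV - {t, s}) (del_edges ?TE {t, s}) = graph_rank (?GV - {t, s}) (del_edges ?GE {t, s})"
        proof (rule IH)
          show "insert y (set vs) = \<Union>(block ` {t, s})" using ty C(1) set_vs by simp
          show "extremal (V - insert y (set vs)) (del_edges E (insert y (set vs))) \<phi>"
            using Hy(1) unfolding Vy Ey .
        qed (use s(1) t(1) in auto)
        moreover have "{D \<in> cycles E. Inr D \<notin> {t, s}} = {D \<in> cycles E. Inr D \<notin> {s}}" using ty by auto
        ultimately have "graph_rank (?V - {y}) (del_edges ?E {y}) =
            graph_rank (?TV - {t, s}) (del_edges ?TE {t, s}) + (\<Sum>D\<in>{D \<in> cycles E. Inr D \<notin> {s}}. ?c D)"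
          unfolding Vy Ey by simp
        moreover have "graph_rank ?TV ?TE = graph_rank (?TV - {t, s}) (del_edges ?TE {t, s}) + 2"
          by (rule graph_rank_pendant[OF TG_simple pendant])
        moreover have "?c C = length vs" using card_cyc_verts[OF vs(1)] vs(2) by simp
        \<comment> \<open>Both T_G and G without the cycle lose rank 2 with the pendant pair and
          with \<open>y\<close>, respectively, which gives the formula for G. Comparison with
          \<open>H\<close> yields r(T_G) = r(T_G - s), and \<open>H\<close> equates the latter with
          r(Gamma_G).\<close>
        ultimately show ?thesis using H Hy(2) end_cycle(2) sum_C by linarith
      qed
    qed
  qed
qed

theorem theorem4p6:
  fixes V :: "'a set" and E :: "'a set set" and \<phi> :: "'a \<Rightarrow> 'a \<Rightarrow> complex"
  assumes "gain_graph V E \<phi>"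
    and "int (gain_rank V E \<phi>) = int (graph_rank V E) - 2 * theta V E"
  shows "(\<forall>C1\<in>cycles E. \<forall>C2\<in>cycles E. C1 \<noteq> C2 \<longrightarrow> cyc_verts C1 \<inter> cyc_verts C2 = {})
     \<and> (\<forall>vs. cycle_list E vs \<longrightarrow> type_A \<phi> vs \<and> length vs mod 4 = 2)
     \<and> int (graph_rank V E) =
          int (graph_rank (TG_verts V E) (TG_edges V E)) + (\<Sum>C\<in>cycles E. int (card (cyc_verts C)))
     \<and> graph_rank (TG_verts V E) (TG_edges V E) = graph_rank (Gamma_verts V E) (Gamma_edges V E)"
proof -
  have ext: "extremal V E \<phi>" using assms unfolding extremal_def by blast
  have "int (graph_rank V E) =
      int (graph_rank (TG_verts V E) (TG_edges V E)) + (\<Sum>C\<in>cycles E. int (card (cyc_verts C)))"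
    using extremal_contraction_rank[OF ext] by simp
  then show ?thesis
    using extremal_cycles_disjoint[OF ext] extremal_cycle_type[OF ext] extremal_contraction_rank[OF ext] by blast
qed

end
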